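(* Let $\mathcal{G}=(A,(\preceq_i)_{i\in\mathcal{P}})$ be a game whose preference relations $\preceq_i$ are all $\omega$-recognizable preorders. Then from every initial vertex there exists a Nash equilibrium composed of finite-memory strategies.
   Context: An arena is $A=(V,E,\mathcal{P},(V_i)_i)$ with finite vertex set $V$, edges $E$ (every vertex has a successor), finite player set $\mathcal{P}$ and partition $(V_i)_i$. A relation on $V^\omega$ is $\omega$-recognizable if it equals $\bigcup_{k=1}^{\ell}X_k\times Y_k$ with $X_k,Y_k\subseteq V^\omega$ $\omega$-regular; a preorder is reflexive and transitive. From $\preceq_i$ define the strict part $x\prec_i y$ iff $x\preceq_i y$ and $y\not\preceq_i x$. A strategy of player $i$ maps histories ending in $V_i$ to successors; it is finite-memory if defined by a finite Mealy machine. A Nash equilibrium from $v_0$ is a profile $\sigma$ such that for every player $i$ and every strategy $\tau_i$ of player $i$, $\langle\sigma\rangle_{v_0}\not\prec_i\langle\tau_i,\sigma_{-i}\rangle_{v_0}$, where $\langle\cdot\rangle_{v_0}$ denotes the outcome from $v_0$. *)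

theory Defs
  imports Main
begin

definition buchi_accepts ::
  "nat set \<Rightarrow> nat set \<Rightarrow> (nat \<times> 'v \<times> nat) set \<Rightarrow> nat set \<Rightarrow> (nat \<Rightarrow> 'v) \<Rightarrow> bool" where
  "buchi_accepts Q I D F w \<longleftrightarrow>
     (\<exists>r. r 0 \<in> I \<and> (\<forall>n. (r n, w n, r (Suc n)) \<in> D) \<and> (\<exists>\<^sub>\<infinity> n. r n \<in> F))"

definition omega_regular :: "(nat \<Rightarrow> 'v) set \<Rightarrow> bool" where
  "omega_regular X \<longleftrightarrow>
     (\<exists>Q I D F. finite Q \<and> I \<subseteq> Q \<and> F \<subseteq> Q \<and> D \<subseteq> Q \<times> UNIV \<times> Q \<and>
        X = {w. buchi_accepts Q I D F w})"

definition omega_recognizable :: "((nat \<Rightarrow> 'v) \<times> (nat \<Rightarrow> 'v)) set \<Rightarrow> bool" where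
  "omega_recognizable R \<longleftrightarrow>
     (\<exists>XY :: ((nat \<Rightarrow> 'v) set \<times> (nat \<Rightarrow> 'v) set) list.
        (\<forall>(X, Y) \<in> set XY. omega_regular X \<and> omega_regular Y) \<and>
        R = (\<Union>(X, Y) \<in> set XY. X \<times> Y))"

text \<open>Arena: vertex type 'v (finite), player type 'p (finite), edge relation E,
  owner function (the partition (V_i)). A strategy is a function from histories
  (nonempty vertex lists) to vertices; a strategy profile maps players to strategies.\<close>

definition is_strategy ::
  "('v \<times> 'v) set \<Rightarrow> ('v \<Rightarrow> 'p) \<Rightarrow> 'p \<Rightarrow> ('v list \<Rightarrow> 'v) \<Rightarrow> bool" where
  "is_strategy E owner i s \<longleftrightarrow>
     (\<forall>h. h \<noteq> [] \<and> owner (last h) = i \<longrightarrow> (last h, s h) \<in> E)"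

definition finite_memory ::
  "('v \<Rightarrow> 'p) \<Rightarrow> 'p \<Rightarrow> ('v list \<Rightarrow> 'v) \<Rightarrow> bool" where
  "finite_memory owner i s \<longleftrightarrow>
     (\<exists>(M :: nat set) m0 upd nxt. finite M \<and> m0 \<in> M \<and>
        (\<forall>m v. m \<in> M \<longrightarrow> upd m v \<in> M) \<and>
        (\<forall>h. h \<noteq> [] \<and> owner (last h) = i \<longrightarrow>
              s h = nxt (foldl upd m0 (butlast h)) (last h)))"

fun hist :: "('v \<Rightarrow> 'p) \<Rightarrow> ('p \<Rightarrow> 'v list \<Rightarrow> 'v) \<Rightarrow> 'v \<Rightarrow> nat \<Rightarrow> 'v list" where
  "hist owner \<sigma> v0 0 = [v0]"
| "hist owner \<sigma> v0 (Suc n) =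
     hist owner \<sigma> v0 n @ [\<sigma> (owner (last (hist owner \<sigma> v0 n))) (hist owner \<sigma> v0 n)]"

definition outcome :: "('v \<Rightarrow> 'p) \<Rightarrow> ('p \<Rightarrow> 'v list \<Rightarrow> 'v) \<Rightarrow> 'v \<Rightarrow> (nat \<Rightarrow> 'v)" where
  "outcome owner \<sigma> v0 = (\<lambda>n. last (hist owner \<sigma> v0 n))"

definition strict_pref :: "('a \<times> 'a) set \<Rightarrow> 'a \<Rightarrow> 'a \<Rightarrow> bool" where
  "strict_pref R x y \<longleftrightarrow> (x, y) \<in> R \<and> (y, x) \<notin> R"

definition nash_equilibrium ::
  "('v \<times> 'v) set \<Rightarrow> ('v \<Rightarrow> 'p) \<Rightarrow> ('p \<Rightarrow> ((nat \<Rightarrow> 'v) \<times> (nat \<Rightarrow> 'v)) set)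
    \<Rightarrow> ('p \<Rightarrow> 'v list \<Rightarrow> 'v) \<Rightarrow> 'v \<Rightarrow> bool" where
  "nash_equilibrium E owner pref \<sigma> v0 \<longleftrightarrow>
     (\<forall>i. is_strategy E owner i (\<sigma> i)) \<and>
     (\<forall>i \<tau>. is_strategy E owner i \<tau> \<longrightarrow>
        \<not> strict_pref (pref i) (outcome owner \<sigma> v0) (outcome owner (\<sigma>(i := \<tau>)) v0))"

end

theory Submission
  imports Defs "HOL-Library.Infinite_Set"
begin

text \<open>All the \<open>\<omega>\<close>-regular languages that occur in the preference relations are recognized by one
  finite congruence on finite words. Counting the membership patterns strictly below a word
  turns every preference into a payoff function with finitely many values, and the sets
  \<open>{w. c \<le> pay i w}\<close> are recognized by the same congruence. They are determinized by following
  the values of the suffixes read so far: two suffixes with the same value merge, and keeping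
  the surviving ones in order of age yields a parity condition. In the product of the arena with
  this automaton, every threshold of every player is thus a positionally determined parity
  game, and every state has a value for every player. In the equilibrium each player plays
  a winning strategy for the current own value, which never decreases along the play, until
  someone deviates; from then on the others hold the deviator down to the value of the state
  reached by the deviation.\<close>

section \<open>Positional determinacy of parity games\<close>

text \<open>A preorder here may leave outcomes incomparable, and the interests of the players are
  unrelated. An equilibrium only has to exclude strict improvements, so any payoff that increases
  along every strict preference will do, whatever order it imposes on incomparable outcomes. Each
  threshold of such a payoff gives a zero-sum game of one player against the coalition of all
  others, which is where determinacy applies. Winning strategies are positional in the product, so
  the memory consists of the automaton state and what is needed to recognize a deviator. Following
  suffix values is enough for membership: if a fixed position keeps absorbing younger ones, always
  across a factor of value \<open>e\<close>, the word splits into factors of values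
  \<open>s e\<close>, \<open>e\<close>, \<open>e\<close>, ..., where \<open>s\<close> is the value
  of the prefix before that position. Membership depends on the pair \<open>(s, e)\<close> only, so
  the parity condition merely has to single out one position that absorbs forever.\<close>

definition parity_wins :: "('s \<Rightarrow> nat) \<Rightarrow> bool \<Rightarrow> (nat \<Rightarrow> 's) \<Rightarrow> bool" where
  "parity_wins pr a \<pi> \<longleftrightarrow>
     (\<exists>p. (\<exists>\<^sub>\<infinity>n. pr (\<pi> n) = p) \<and> (\<forall>\<^sub>\<infinity>n. p \<le> pr (\<pi> n)) \<and> even p = a)"

section \<open>Limit behaviour of priority sequences\<close>

lemma INFM_shift: "(\<exists>\<^sub>\<infinity>n::nat. P (n + k)) \<longleftrightarrow> (\<exists>\<^sub>\<infinity>n. P n)"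
proof
  assume L: "\<exists>\<^sub>\<infinity>n. P (n + k)"
  show "\<exists>\<^sub>\<infinity>n. P n"
    unfolding INFM_nat
  proof
    fix m
    obtain n where "n > m" "P (n + k)" using L unfolding INFM_nat by blast
    then show "\<exists>n>m. P n" by (intro exI[of _ "n + k"]) auto
  qed
next
  assume R: "\<exists>\<^sub>\<infinity>n. P n"
  show "\<exists>\<^sub>\<infinity>n. P (n + k)"
    unfolding INFM_nat
  proof
    fix m
    obtain n where "n > m + k" "P n" using R unfolding INFM_nat by blast
    then show "\<exists>n>m. P (n + k)" by (intro exI[of _ "n - k"]) auto
  qed
qed

lemma MOST_shift: "(\<forall>\<^sub>\<infinity>n::nat. P (n + k)) \<longleftrightarrow> (\<forall>\<^sub>\<infinity>n. P n)"
  using INFM_shift[of "\<lambda>n. \<not> P n" k]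
  unfolding not_MOST[symmetric] by blast

lemma liminf_nat:
  fixes p :: "nat \<Rightarrow> nat"
  assumes "\<And>k. p k \<le> M"
  obtains m where "\<exists>\<^sub>\<infinity>k. p k = m" "\<forall>\<^sub>\<infinity>k. m \<le> p k"
proof -
  have "\<exists>\<^sub>\<infinity>k. \<exists>m\<in>{..M}. p k = m" using assms by (simp add: INFM_nat_le)
  from frequently_bex_finite[OF finite_atMost this] have "\<exists>m. \<exists>\<^sub>\<infinity>k. p k = m" by blast
  then obtain m where m: "\<exists>\<^sub>\<infinity>k. p k = m" "\<And>i. i < m \<Longrightarrow> \<not> (\<exists>\<^sub>\<infinity>k. p k = i)"
    using exists_least_iff[of "\<lambda>m. \<exists>\<^sub>\<infinity>k. p k = m"] by blast
  have "\<not> (\<exists>\<^sub>\<infinity>k. \<exists>i\<in>{..<m}. p k = i)"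
    using m(2) frequently_bex_finite[OF finite_lessThan[of m], of "\<lambda>k i. p k = i"] by blast
  then have "\<forall>\<^sub>\<infinity>k. m \<le> p k" unfolding not_INFM by (rule MOST_mono) (simp add: not_less[symmetric])
  then show ?thesis using that m(1) by blast
qed

lemma parity_wins_shift: "parity_wins pr a (\<lambda>n. \<pi> (n + k)) \<longleftrightarrow> parity_wins pr a \<pi>"
  unfolding parity_wins_def
  using INFM_shift[of "\<lambda>n. pr (\<pi> n) = p" k for p] MOST_shift[of "\<lambda>n. p \<le> pr (\<pi> n)" k for p]
  by simp

lemma parity_wins_exclusive: "parity_wins pr True \<pi> \<Longrightarrow> \<not> parity_wins pr False \<pi>"
proof
  assume "parity_wins pr True \<pi>" "parity_wins pr False \<pi>"
  then obtain p q where pq: "\<exists>\<^sub>\<infinity>n. pr (\<pi> n) = p" "\<forall>\<^sub>\<infinity>n. p \<le> pr (\<pi> n)" "even p"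
    "\<exists>\<^sub>\<infinity>n. pr (\<pi> n) = q" "\<forall>\<^sub>\<infinity>n. q \<le> pr (\<pi> n)" "odd q"
    unfolding parity_wins_def by auto
  have "q \<le> p" using INFM_conjI[OF pq(1) pq(5)] by (auto dest: INFM_EX)
  moreover have "p \<le> q" using INFM_conjI[OF pq(4) pq(2)] by (auto dest: INFM_EX)
  ultimately show False using pq by auto
qed

lemma parity_wins_unique: "parity_wins pr a \<pi> \<Longrightarrow> parity_wins pr b \<pi> \<Longrightarrow> a = b"
  using parity_wins_exclusive[of pr \<pi>] by (cases a; cases b) auto

text \<open>Player \<open>True\<close> aims at an even least recurring priority, and
  \<open>own v\<close> is the player to move. The vertex set \<open>U\<close> is a parameter because
  the recursion removes vertices. The last clause speaks only of plays inside \<open>W\<close>; the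
  closure clauses keep plays of the subgame \<open>U\<close> there.\<close>

definition region ::
  "('s \<times> 's) set \<Rightarrow> ('s \<Rightarrow> bool) \<Rightarrow> ('s \<Rightarrow> nat) \<Rightarrow> 's set \<Rightarrow> bool \<Rightarrow> 's set \<Rightarrow> ('s \<Rightarrow> 's) \<Rightarrow> bool" where
  "region E own pr U a W f \<longleftrightarrow> W \<subseteq> U \<and>
     (\<forall>v\<in>W. own v = a \<longrightarrow> f v \<in> W \<and> (v, f v) \<in> E) \<and>
     (\<forall>v\<in>W. own v \<noteq> a \<longrightarrow> (\<forall>w\<in>U. (v, w) \<in> E \<longrightarrow> w \<in> W)) \<and>
     (\<forall>\<pi>. (\<forall>n. \<pi> n \<in> W \<and> (\<pi> n, \<pi> (Suc n)) \<in> E \<and>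
              (own (\<pi> n) = a \<longrightarrow> \<pi> (Suc n) = f (\<pi> n))) \<longrightarrow> parity_wins pr a \<pi>)"

lemma regionD:
  assumes "region E own pr U a W f"
  shows "W \<subseteq> U"
    and "v \<in> W \<Longrightarrow> own v = a \<Longrightarrow> f v \<in> W"
    and "v \<in> W \<Longrightarrow> own v = a \<Longrightarrow> (v, f v) \<in> E"
    and "v \<in> W \<Longrightarrow> own v \<noteq> a \<Longrightarrow> w \<in> U \<Longrightarrow> (v, w) \<in> E \<Longrightarrow> w \<in> W"
  using assms unfolding region_def by blast+

lemma region_eventually_wins:
  assumes reg: "region E own pr U a W f"
    and "\<And>n. n \<ge> k \<Longrightarrow> \<pi> n \<in> W" "\<And>n. n \<ge> k \<Longrightarrow> (\<pi> n, \<pi> (Suc n)) \<in> E"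
    and "\<And>n. n \<ge> k \<Longrightarrow> own (\<pi> n) = a \<Longrightarrow> \<pi> (Suc n) = f (\<pi> n)"
  shows "parity_wins pr a \<pi>"
proof -
  have "parity_wins pr a (\<lambda>n. \<pi> (n + k))"
    using reg assms(2-) unfolding region_def by simp
  then show ?thesis by (simp add: parity_wins_shift)
qed

lemma region_play_stays:
  assumes reg: "region E own pr U a W f"
    and "\<pi> k \<in> W" "\<And>n. n \<ge> k \<Longrightarrow> \<pi> n \<in> U" "\<And>n. n \<ge> k \<Longrightarrow> (\<pi> n, \<pi> (Suc n)) \<in> E"
    and "\<And>n. n \<ge> k \<Longrightarrow> \<pi> n \<in> W \<Longrightarrow> own (\<pi> n) = a \<Longrightarrow> \<pi> (Suc n) = f (\<pi> n)"
    and "n \<ge> k"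
  shows "\<pi> n \<in> W"
  using \<open>n \<ge> k\<close>
proof (induction n rule: dec_induct)
  case base
  show ?case by fact
next
  case (step n)
  show ?case
  proof (cases "own (\<pi> n) = a")
    case True
    then show ?thesis using assms(5)[of n] step regionD(2)[OF reg] by metis
  next
    case False
    then show ?thesis using step assms(3)[of "Suc n"] assms(4)[of n] regionD(4)[OF reg] by auto
  qed
qed

section \<open>Attractors in a subgame\<close>

definition attracting ::
  "('s \<times> 's) set \<Rightarrow> ('s \<Rightarrow> bool) \<Rightarrow> 's set \<Rightarrow> bool \<Rightarrow> 's set \<Rightarrow> 's set \<Rightarrow> ('s \<Rightarrow> 's) \<Rightarrow> bool" where
  "attracting E own U a T A f \<longleftrightarrow> T \<subseteq> A \<and> A \<subseteq> U \<and>
     (\<forall>v\<in>A - T. own v = a \<longrightarrow> f v \<in> A \<and> (v, f v) \<in> E) \<and>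
     (\<forall>v\<in>A - T. own v \<noteq> a \<longrightarrow> (\<forall>w\<in>U. (v, w) \<in> E \<longrightarrow> w \<in> A)) \<and>
     (\<forall>v\<in>U - A. own v = a \<longrightarrow> (\<forall>w\<in>A. (v, w) \<notin> E)) \<and>
     (\<forall>v\<in>U - A. \<exists>w\<in>U - A. (v, w) \<in> E) \<and>
     (\<forall>\<pi> k. \<pi> k \<in> A \<longrightarrow> (\<forall>n\<ge>k. \<pi> n \<in> U \<and> (\<pi> n, \<pi> (Suc n)) \<in> E \<and>
        (\<pi> n \<in> A - T \<longrightarrow> own (\<pi> n) = a \<longrightarrow> \<pi> (Suc n) = f (\<pi> n))) \<longrightarrow> (\<exists>n\<ge>k. \<pi> n \<in> T))"

lemma attractingD:
  assumes "attracting E own U a T A f"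
  shows "T \<subseteq> A" "A \<subseteq> U"
    and "v \<in> A \<Longrightarrow> v \<notin> T \<Longrightarrow> own v = a \<Longrightarrow> f v \<in> A"
    and "v \<in> A \<Longrightarrow> v \<notin> T \<Longrightarrow> own v = a \<Longrightarrow> (v, f v) \<in> E"
    and "v \<in> A \<Longrightarrow> v \<notin> T \<Longrightarrow> own v \<noteq> a \<Longrightarrow> w \<in> U \<Longrightarrow> (v, w) \<in> E \<Longrightarrow> w \<in> A"
    and "v \<in> U \<Longrightarrow> v \<notin> A \<Longrightarrow> own v = a \<Longrightarrow> w \<in> A \<Longrightarrow> (v, w) \<notin> E"
    and "v \<in> U - A \<Longrightarrow> \<exists>w\<in>U - A. (v, w) \<in> E"
  using assms unfolding attracting_def by simp_all

lemma attracting_reaches: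
  assumes "attracting E own U a T A f" "\<pi> k \<in> A"
    and "\<And>n. n \<ge> k \<Longrightarrow> \<pi> n \<in> U" "\<And>n. n \<ge> k \<Longrightarrow> (\<pi> n, \<pi> (Suc n)) \<in> E"
    and "\<And>n. n \<ge> k \<Longrightarrow> \<pi> n \<in> A \<Longrightarrow> \<pi> n \<notin> T \<Longrightarrow> own (\<pi> n) = a \<Longrightarrow> \<pi> (Suc n) = f (\<pi> n)"
  shows "\<exists>n\<ge>k. \<pi> n \<in> T"
  using assms unfolding attracting_def by simp

text \<open>Among the subsets of \<open>U\<close> with a rank that decreases outside
  \<open>T\<close>, along the chosen moves of \<open>a\<close> and along all moves of the opponent,
  one of greatest cardinality is taken. A vertex violating one of the conditions on
  \<open>U - A\<close> could be added, so maximality replaces the iteration of one-step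
  predecessors.\<close>

lemma attractor:
  assumes "finite U" "T \<subseteq> U"
    and total: "\<And>v. v \<in> U \<Longrightarrow> \<exists>w\<in>U. (v, w) \<in> E"
  shows "\<exists>A f. attracting E own U a T A f"
proof -
  define good where "good A f r \<longleftrightarrow> T \<subseteq> A \<and> A \<subseteq> U \<and>
     (\<forall>v\<in>A - T. own v = a \<longrightarrow> f v \<in> A \<and> (v, f v) \<in> E \<and> r (f v) < r v) \<and>
     (\<forall>v\<in>A - T. own v \<noteq> a \<longrightarrow> (\<forall>w\<in>U. (v, w) \<in> E \<longrightarrow> w \<in> A \<and> r w < r v))"
    for A f and r :: "'a \<Rightarrow> nat"
  have "good T undefined undefined" using assms unfolding good_def by auto
  then have ex: "\<exists>f r. good T f r" by blast
  have bound: "\<forall>A. (\<exists>f r. good A f r) \<longrightarrow> card A < Suc (card U)"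
    using assms(1) unfolding good_def by (auto simp: less_Suc_eq_le intro: card_mono)
  obtain A where A: "\<exists>f r. good A f r" "\<And>B. \<exists>f r. good B f r \<Longrightarrow> card B \<le> card A"
    using ex_has_greatest_nat[OF ex bound] by auto
  obtain f r where g: "good A f r" using A(1) by blast
  have TA: "T \<subseteq> A" "A \<subseteq> U" using g unfolding good_def by auto
  have finA: "finite A" using TA assms(1) finite_subset by blast
  have no_ext: "\<not> good (insert v A) f' r'" if "v \<in> U - A" for v f' r'
    using A(2)[of "insert v A"] finA that by auto
  \<comment> \<open>\<open>m\<close> exceeds all ranks on \<open>A\<close> and can therefore rank a
    new vertex; \<open>insert 0\<close> covers an empty \<open>A\<close>.\<close>
  define m where "m = Suc (Max (insert 0 (r ` A)))"
  have m: "r w < m" if "w \<in> A" for w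
    unfolding m_def using that finA by (intro le_imp_less_Suc Max_ge) auto
  have g1: "f x \<in> A" "(x, f x) \<in> E" "r (f x) < r x" if "x \<in> A" "x \<notin> T" "own x = a" for x
    using g that unfolding good_def by blast+
  have g2: "y \<in> A" "r y < r x" if "x \<in> A" "x \<notin> T" "own x \<noteq> a" "y \<in> U" "(x, y) \<in> E" for x y
    using g that unfolding good_def by blast+
  have c1: "(v, w) \<notin> E" if v: "v \<in> U - A" "own v = a" "w \<in> A" for v w
  proof
    assume "(v, w) \<in> E"
    then have "good (insert v A) (f(v := w)) (r(v := m))"
      unfolding good_def
    proof (intro conjI ballI impI)
      fix x assume "x \<in> insert v A - T" "own x = a"
      then show "(f(v := w)) x \<in> insert v A" "(x, (f(v := w)) x) \<in> E"
        "(r(v := m)) ((f(v := w)) x) < (r(v := m)) x"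
        using v m[of w] g1[of x] m[of "f x"] \<open>(v, w) \<in> E\<close> by (cases "x = v"; force)+
    next
      fix x y assume "x \<in> insert v A - T" "own x \<noteq> a" "y \<in> U" "(x, y) \<in> E"
      then show "y \<in> insert v A" "(r(v := m)) y < (r(v := m)) x"
        using v g2[of x y] by (cases "x = v"; force)+
    qed (use TA v in auto)
    then show False using no_ext v(1) by blast
  qed
  have c2: "\<exists>w\<in>U - A. (v, w) \<in> E" if v: "v \<in> U - A" for v
  proof (cases "own v = a")
    case True
    then show ?thesis using c1[OF v] total[of v] v by blast
  next
    case False
    show ?thesis
    proof (rule ccontr)
      assume "\<not> ?thesis"
      then have "good (insert v A) f (r(v := m))"
        unfolding good_def
      proof (intro conjI ballI impI)
        fix x assume "x \<in> insert v A - T" "own x = a"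
        then show "f x \<in> insert v A" "(x, f x) \<in> E" "(r(v := m)) (f x) < (r(v := m)) x"
          using v False g1[of x] by (cases "x = v"; force)+
      next
        fix x y assume xy: "x \<in> insert v A - T" "own x \<noteq> a" "y \<in> U" "(x, y) \<in> E"
        have "y \<in> A" if "x = v"
          using \<open>\<not> (\<exists>w\<in>U - A. (v, w) \<in> E)\<close> xy that by blast
        then show "y \<in> insert v A" "(r(v := m)) y < (r(v := m)) x"
          using xy v g2[of x y] m[of y] by (cases "x = v"; force)+
      qed (use TA v in auto)
      then show False using no_ext v(1) by blast
    qed
  qed
  have reach: "\<exists>n\<ge>k. \<pi> n \<in> T"
    if "\<pi> k \<in> A" "\<And>n. n \<ge> k \<Longrightarrow> \<pi> n \<in> U" "\<And>n. n \<ge> k \<Longrightarrow> (\<pi> n, \<pi> (Suc n)) \<in> E"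
      "\<And>n. n \<ge> k \<Longrightarrow> \<pi> n \<in> A - T \<Longrightarrow> own (\<pi> n) = a \<Longrightarrow> \<pi> (Suc n) = f (\<pi> n)" for \<pi> k
    using that
  proof (induction "r (\<pi> k)" arbitrary: k rule: less_induct)
    case less
    show ?case
    proof (cases "\<pi> k \<in> T")
      case True
      then show ?thesis by auto
    next
      case False
      have "\<pi> (Suc k) \<in> A \<and> r (\<pi> (Suc k)) < r (\<pi> k)"
        using less.prems(1) less.prems(2)[of "Suc k"] less.prems(3)[of k] less.prems(4)[of k] g False
        unfolding good_def by (cases "own (\<pi> k) = a") auto
      then have "\<exists>n\<ge>Suc k. \<pi> n \<in> T"
        using less.prems by (intro less.hyps) auto
      then show ?thesis using Suc_leD by blast
    qed
  qed
  have "attracting E own U a T A f"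
    unfolding attracting_def
  proof (intro conjI)
    show "\<forall>\<pi> k. \<pi> k \<in> A \<longrightarrow> (\<forall>n\<ge>k. \<pi> n \<in> U \<and> (\<pi> n, \<pi> (Suc n)) \<in> E \<and>
       (\<pi> n \<in> A - T \<longrightarrow> own (\<pi> n) = a \<longrightarrow> \<pi> (Suc n) = f (\<pi> n))) \<longrightarrow> (\<exists>n\<ge>k. \<pi> n \<in> T)"
      using reach by metis
  qed (use TA g c1 c2 in \<open>auto simp: good_def\<close>)
  then show ?thesis by blast
qed

section \<open>Transferring and gluing regions of subgames\<close>

lemma region_in_trap:
  assumes reg: "region E own pr (U - A) a W f"
    and "\<And>v w. v \<in> U - A \<Longrightarrow> own v \<noteq> a \<Longrightarrow> w \<in> A \<Longrightarrow> (v, w) \<notin> E"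
  shows "region E own pr U a W f"
  unfolding region_def
proof (intro conjI ballI allI impI)
  fix \<pi>
  assume "\<forall>n. \<pi> n \<in> W \<and> (\<pi> n, \<pi> (Suc n)) \<in> E \<and> (own (\<pi> n) = a \<longrightarrow> \<pi> (Suc n) = f (\<pi> n))"
  then show "parity_wins pr a \<pi>"
    by (intro region_eventually_wins[OF reg, where \<pi> = \<pi> and k = 0]) auto
qed (use assms(2) regionD[OF reg] in blast)+

text \<open>The attractor strategy leads into \<open>W\<close>, where \<open>f\<close> takes over
  and keeps the play. The last two conclusions make \<open>U - B\<close> a subgame from which
  \<open>a\<close> has no move into \<open>B\<close>.\<close>

lemma region_attractor:
  assumes "finite U" and total: "\<forall>v\<in>U. \<exists>w\<in>U. (v, w) \<in> E"
    and reg: "region E own pr U a W f"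
  obtains B g where "W \<subseteq> B" "region E own pr U a B g"
    "\<forall>v\<in>U - B. own v = a \<longrightarrow> (\<forall>w\<in>B. (v, w) \<notin> E)"
    "\<forall>v\<in>U - B. \<exists>w\<in>U - B. (v, w) \<in> E"
proof -
  have "W \<subseteq> U" using regionD(1)[OF reg] .
  obtain B h where B: "attracting E own U a W B h"
    using attractor[OF \<open>finite U\<close> \<open>W \<subseteq> U\<close>] total by blast
  note B' = attractingD[OF B]
  define g where "g v = (if v \<in> W then f v else h v)" for v
  have "region E own pr U a B g"
    unfolding region_def
  proof (intro conjI allI impI ballI)
    fix \<pi>
    assume \<pi>: "\<forall>n. \<pi> n \<in> B \<and> (\<pi> n, \<pi> (Suc n)) \<in> E \<and> (own (\<pi> n) = a \<longrightarrow> \<pi> (Suc n) = g (\<pi> n))"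
    then have "\<exists>n\<ge>0. \<pi> n \<in> W"
      using B'(2) by (intro attracting_reaches[OF B, where \<pi> = \<pi> and k = 0]) (auto simp: g_def)
    then obtain k where k: "\<pi> k \<in> W" by blast
    have "\<pi> n \<in> W" if "n \<ge> k" for n
      using \<pi> B'(2) by (intro region_play_stays[OF reg, where \<pi> = \<pi> and k = k, OF k _ _ _ that]) (auto simp: g_def)
    then show "parity_wins pr a \<pi>"
      using \<pi> by (intro region_eventually_wins[OF reg, where \<pi> = \<pi> and k = k]) (auto simp: g_def)
  next
    show "B \<subseteq> U" using B'(2) .
  next
    fix v assume v: "v \<in> B" "own v = a"
    show "g v \<in> B" "(v, g v) \<in> E"
      using v B'(1) B'(3)[of v] B'(4)[of v] regionD(2,3)[OF reg, of v] by (auto simp: g_def)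
  next
    fix v w assume v: "v \<in> B" "own v \<noteq> a" "w \<in> U" "(v, w) \<in> E"
    show "w \<in> B"
      using v B'(1) B'(5)[of v w] regionD(4)[OF reg, of v w] by blast
  qed
  then show ?thesis using that[of B g] B'(1,6,7) by simp
qed

text \<open>The opponent may move from \<open>W\<close> into \<open>B\<close>, but a play that
  enters \<open>B\<close> stays there; any other play remains in the subgame
  \<open>U - B\<close>.\<close>

lemma region_union:
  assumes r1: "region E own pr U a B f" and r2: "region E own pr (U - B) a W g"
  shows "region E own pr U a (B \<union> W) (\<lambda>v. if v \<in> B then f v else g v)"
  unfolding region_def
proof (intro conjI allI impI ballI)
  fix \<pi>
  assume \<pi>: "\<forall>n. \<pi> n \<in> B \<union> W \<and> (\<pi> n, \<pi> (Suc n)) \<in> E \<and>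
    (own (\<pi> n) = a \<longrightarrow> \<pi> (Suc n) = (if \<pi> n \<in> B then f (\<pi> n) else g (\<pi> n)))"
  have BW: "B \<union> W \<subseteq> U" using regionD(1)[OF r1] regionD(1)[OF r2] by blast
  show "parity_wins pr a \<pi>"
  proof (cases "\<exists>k. \<pi> k \<in> B")
    case True
    then obtain k where k: "\<pi> k \<in> B" by blast
    have "\<pi> n \<in> B" if "n \<ge> k" for n
      using \<pi> BW by (intro region_play_stays[OF r1, where \<pi> = \<pi> and k = k, OF k _ _ _ that]) auto
    then show ?thesis
      using \<pi> by (intro region_eventually_wins[OF r1, where \<pi> = \<pi> and k = k]) auto
  next
    case False
    then show ?thesis
      using \<pi> by (intro region_eventually_wins[OF r2, where \<pi> = \<pi> and k = 0]) auto
  qed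
next
  show "B \<union> W \<subseteq> U" using regionD(1)[OF r1] regionD(1)[OF r2] by blast
next
  fix v assume v: "v \<in> B \<union> W" "own v = a"
  show "(if v \<in> B then f v else g v) \<in> B \<union> W" "(v, if v \<in> B then f v else g v) \<in> E"
    using v regionD(2,3)[OF r1, of v] regionD(2,3)[OF r2, of v] by auto
next
  fix v w assume v: "v \<in> B \<union> W" "own v \<noteq> a" "w \<in> U" "(v, w) \<in> E"
  then show "w \<in> B \<union> W"
    using regionD(4)[OF r1, of v w] regionD(4)[OF r2, of v w] by blast
qed

text \<open>Zielonka's recursion. The player \<open>c\<close> favoured by the least priority
  \<open>d\<close> attracts to \<open>d\<close>. If the opponent wins nothing in the rest,
  \<open>c\<close> wins everywhere: a play either returns to \<open>A\<close> forever, and then sees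
  \<open>d\<close> infinitely often, or ends up in the rest. Otherwise the part won by the opponent,
  closed under attraction, is won in \<open>U\<close> as well and can be removed.\<close>

theorem parity_determinacy:
  fixes E :: "('s \<times> 's) set"
  assumes "finite U" and "\<And>v. v \<in> U \<Longrightarrow> \<exists>w\<in>U. (v, w) \<in> E"
  shows "\<exists>W f g. region E own pr U a W f \<and> region E own pr U (\<not> a) (U - W) g"
  using assms
proof (induction "card U" arbitrary: U a rule: less_induct)
  case less
  define det where "det U a \<longleftrightarrow> (\<exists>W f g. region E own pr U a W f \<and> region E own pr U (\<not> a) (U - W) g)"
    for U :: "'s set" and a
  \<comment> \<open>Interchanging the players only complements \<open>W\<close>, so the case of
    \<open>c\<close> suffices.\<close>
  have sym: "det U (\<not> a) \<Longrightarrow> det U a" for U a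
    unfolding det_def by (metis double_diff regionD(1) subset_refl)
  have IH: "det X c" if "X \<subset> U" "\<And>v. v \<in> X \<Longrightarrow> \<exists>w\<in>X. (v, w) \<in> E" for X c
    unfolding det_def using that less.hyps[of X c] less.prems(1)
    by (meson finite_subset psubset_card_mono psubset_imp_subset)
  show ?case
  proof (cases "U = {}")
    case True
    then show ?thesis by (auto simp: region_def)
  next
    case False
    define d where "d = Min (pr ` U)"
    define c where "c = even d"
    define T where "T = {v \<in> U. pr v = d}"
    have "d \<in> pr ` U" unfolding d_def using False less.prems(1) by (intro Min_in) auto
    then have T: "T \<subseteq> U" "T \<noteq> {}" unfolding T_def by auto
    have d_le: "d \<le> pr v" if "v \<in> U" for v
      unfolding d_def using that less.prems(1) by simp
    obtain A h where A: "attracting E own U c T A h"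
      using attractor[OF less.prems(1) T(1) less.prems(2)] by blast
    note A' = attractingD[OF A]
    have "det (U - A) c" using A'(1,2,7) T by (intro IH) auto
    then obtain W f g where W: "region E own pr (U - A) c W f" "region E own pr (U - A) (\<not> c) (U - A - W) g"
      unfolding det_def by blast
    have "det U c"
    proof (cases "U - A - W = {}")
      case True
      then have WA: "W = U - A" using regionD(1)[OF W(1)] by blast
      \<comment> \<open>On \<open>T\<close> any move inside \<open>U\<close> is good enough, since
        the priority \<open>d\<close> has just been seen.\<close>
      obtain s where s: "\<And>v. v \<in> U \<Longrightarrow> s v \<in> U \<and> (v, s v) \<in> E" using less.prems(2) by metis
      define k where "k v = (if v \<in> T then s v else if v \<in> A then h v else f v)" for v
      have "region E own pr U c U k"
        unfolding region_def
      proof (intro conjI allI impI ballI)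
        fix \<pi>
        assume \<pi>: "\<forall>n. \<pi> n \<in> U \<and> (\<pi> n, \<pi> (Suc n)) \<in> E \<and> (own (\<pi> n) = c \<longrightarrow> \<pi> (Suc n) = k (\<pi> n))"
        show "parity_wins pr c \<pi>"
        proof (cases "\<exists>\<^sub>\<infinity>n. \<pi> n \<in> A")
          case True
          have "\<exists>\<^sub>\<infinity>n. \<pi> n \<in> T"
            unfolding INFM_nat_le
          proof
            fix m
            obtain n where n: "n \<ge> m" "\<pi> n \<in> A" using True unfolding INFM_nat_le by blast
            have "\<exists>n'\<ge>n. \<pi> n' \<in> T" using \<pi> n by (intro attracting_reaches[OF A, where \<pi> = \<pi> and k = n]) (auto simp: k_def)
            then show "\<exists>n\<ge>m. \<pi> n \<in> T" using n order_trans by blast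
          qed
          then have "\<exists>\<^sub>\<infinity>n. pr (\<pi> n) = d" by (rule INFM_mono) (simp add: T_def)
          moreover have "\<forall>\<^sub>\<infinity>n. d \<le> pr (\<pi> n)" using \<pi> d_le by (simp add: ALL_MOST)
          ultimately show ?thesis unfolding parity_wins_def c_def by blast
        next
          case False
          then obtain m where "\<And>n. n \<ge> m \<Longrightarrow> \<pi> n \<notin> A" unfolding INFM_nat_le by blast
          then show ?thesis
            using \<pi> WA A'(1) by (intro region_eventually_wins[OF W(1), where \<pi> = \<pi> and k = m]) (auto simp: k_def)
        qed
      next
        show "U \<subseteq> U" ..
      next
        fix v assume v: "v \<in> U" "own v = c"
        show "k v \<in> U" "(v, k v) \<in> E"
          using v s[of v] A'(2) A'(3)[of v] A'(4)[of v] regionD(2,3)[OF W(1), of v] WA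
          by (auto simp: k_def)
      qed
      moreover have "region E own pr U (\<not> c) (U - U) k" by (auto simp: region_def)
      ultimately show ?thesis unfolding det_def by blast
    next
      case False
      have total: "\<forall>v\<in>U. \<exists>w\<in>U. (v, w) \<in> E" using less.prems(2) by blast
      \<comment> \<open>Outside the attractor \<open>A\<close> player \<open>c\<close> has no move
        into it, so the opponent's region cannot be left through \<open>A\<close>.\<close>
      have R: "region E own pr U (\<not> c) (U - A - W) g"
        by (rule region_in_trap[OF W(2)]) (use A'(6) in auto)
      obtain B g' where B: "U - A - W \<subseteq> B" "region E own pr U (\<not> c) B g'"
        "\<forall>v\<in>U - B. own v = (\<not> c) \<longrightarrow> (\<forall>w\<in>B. (v, w) \<notin> E)"
        "\<forall>v\<in>U - B. \<exists>w\<in>U - B. (v, w) \<in> E"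
        by (rule region_attractor[OF less.prems(1) total R])
      have BU: "B \<subseteq> U" using regionD(1)[OF B(2)] .
      have "det (U - B) c" using B(1,4) BU False by (intro IH) auto
      then obtain X f'' g'' where X: "region E own pr (U - B) c X f''" "region E own pr (U - B) (\<not> c) (U - B - X) g''"
        unfolding det_def by blast
      have "region E own pr U c X f''"
        by (rule region_in_trap[OF X(1)]) (use B(3) in auto)
      moreover have "U - X = B \<union> (U - B - X)" using BU regionD(1)[OF X(1)] by blast
      ultimately show ?thesis unfolding det_def using region_union[OF B(2) X(2)] by metis
    qed
    then have "det U a" using sym[of U a] by (cases "a = c") auto
    then show ?thesis unfolding det_def .
  qed
qed

section \<open>Recognition by finite congruences\<close>

abbreviation seg :: "(nat \<Rightarrow> 'v) \<Rightarrow> nat \<Rightarrow> nat \<Rightarrow> 'v list" where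
  "seg w i j \<equiv> map w [i..<j]"

definition finite_congruence :: "('v list \<Rightarrow> 'm) \<Rightarrow> bool" where
  "finite_congruence \<phi> \<longleftrightarrow> finite (range \<phi>) \<and>
     (\<forall>u u' v v'. \<phi> u = \<phi> u' \<longrightarrow> \<phi> v = \<phi> v' \<longrightarrow> \<phi> (u @ v) = \<phi> (u' @ v'))"

definition same_factors :: "('v list \<Rightarrow> 'm) \<Rightarrow> (nat \<Rightarrow> 'v) \<Rightarrow> (nat \<Rightarrow> 'v) \<Rightarrow> bool" where
  "same_factors \<phi> w w' \<longleftrightarrow>
     (\<exists>f f'. strict_mono f \<and> strict_mono f' \<and> f 0 = 0 \<and> f' 0 = 0 \<and>
        (\<forall>n. \<phi> (seg w (f n) (f (Suc n))) = \<phi> (seg w' (f' n) (f' (Suc n)))))"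

definition recognizes :: "('v list \<Rightarrow> 'm) \<Rightarrow> (nat \<Rightarrow> 'v) set \<Rightarrow> bool" where
  "recognizes \<phi> X \<longleftrightarrow> (\<forall>w w'. same_factors \<phi> w w' \<longrightarrow> w \<in> X \<longrightarrow> w' \<in> X)"

lemma strict_mono_interval:
  fixes f :: "nat \<Rightarrow> nat"
  assumes "strict_mono f" "f 0 \<le> x"
  shows "\<exists>n. f n \<le> x \<and> x < f (Suc n)"
proof -
  have "\<exists>n. x < f n" using strict_mono_imp_increasing[OF assms(1), of "Suc x"] by (metis Suc_le_lessD)
  then obtain n where n: "x < f n" "\<And>m. m < n \<Longrightarrow> \<not> x < f m"
    using exists_least_iff[of "\<lambda>n. x < f n"] by blast
  then obtain m where "n = Suc m" using assms(2) by (cases n) auto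
  then show ?thesis using n(1) n(2)[of m] by (intro exI[of _ m]) auto
qed

lemma strict_mono_interval_unique:
  fixes f :: "nat \<Rightarrow> nat"
  assumes "strict_mono f" "f n \<le> x" "x < f (Suc n)" "f m \<le> x" "x < f (Suc m)"
  shows "m = n"
  using assms by (meson le_less_trans less_Suc_eq_le order_antisym strict_mono_less)

text \<open>The bit tells whether an accepting state occurs after the start state. Excluding the
  start state assigns each later position of a run to exactly one factor, and the bits of
  consecutive factors combine by disjunction.\<close>

fun path :: "(nat \<times> 'v \<times> nat) set \<Rightarrow> nat set \<Rightarrow> nat \<Rightarrow> 'v list \<Rightarrow> nat \<Rightarrow> bool \<Rightarrow> bool" where
  "path D F p [] q b \<longleftrightarrow> p = q \<and> \<not> b"
| "path D F p (x # u) q b \<longleftrightarrow>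
     (\<exists>p' b'. (p, x, p') \<in> D \<and> path D F p' u q b' \<and> b = (p' \<in> F \<or> b'))"

lemma path_append:
  "path D F p (u @ v) q b \<longleftrightarrow> (\<exists>s b1 b2. path D F p u s b1 \<and> path D F s v q b2 \<and> b = (b1 \<or> b2))"
proof (induction u arbitrary: p b)
  case (Cons x u)
  show ?case unfolding append_Cons path.simps Cons.IH by blast
qed auto

lemma path_closed: "path D F p u q b \<Longrightarrow> D \<subseteq> Q \<times> UNIV \<times> Q \<Longrightarrow> p \<in> Q \<Longrightarrow> q \<in> Q"
  by (induction u arbitrary: p b) auto

lemma path_of_run:
  "(\<And>n. n < length u \<Longrightarrow> (r n, u ! n, r (Suc n)) \<in> D) \<Longrightarrow>
   path D F (r 0) u (r (length u)) (\<exists>n<length u. r (Suc n) \<in> F)"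
proof (induction u arbitrary: r)
  case (Cons x u)
  have "path D F (r (Suc 0)) u (r (Suc (length u))) (\<exists>n<length u. r (Suc (Suc n)) \<in> F)"
    using Cons.prems[of "Suc _"] by (intro Cons.IH[of "\<lambda>n. r (Suc n)"]) simp
  moreover have "(r 0, x, r (Suc 0)) \<in> D" using Cons.prems[of 0] by simp
  moreover have "(\<exists>n<Suc (length u). r (Suc n) \<in> F) \<longleftrightarrow>
      r (Suc 0) \<in> F \<or> (\<exists>n<length u. r (Suc (Suc n)) \<in> F)"
    using less_Suc_eq_0_disj by auto
  ultimately show ?case by auto
qed simp

lemma run_of_path:
  "path D F p u q b \<Longrightarrow> \<exists>r. r 0 = p \<and> r (length u) = q \<and>
     (\<forall>n<length u. (r n, u ! n, r (Suc n)) \<in> D) \<and> (b \<longleftrightarrow> (\<exists>n<length u. r (Suc n) \<in> F))"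
proof (induction u arbitrary: p b)
  case (Cons x u)
  then obtain p' b' where p': "(p, x, p') \<in> D" "path D F p' u q b'" "b = (p' \<in> F \<or> b')"
    by auto
  from Cons.IH[OF p'(2)] obtain r where r: "r 0 = p'" "r (length u) = q"
    "\<forall>n<length u. (r n, u ! n, r (Suc n)) \<in> D" "b' \<longleftrightarrow> (\<exists>n<length u. r (Suc n) \<in> F)"
    by blast
  have ex: "(\<exists>n<Suc (length u). P n) \<longleftrightarrow> P 0 \<or> (\<exists>n<length u. P (Suc n))" for P
    using less_Suc_eq_0_disj by auto
  have "\<forall>n<Suc (length u). (case_nat p r n, (x # u) ! n, r n) \<in> D"
    using p'(1) r(1,3) less_Suc_eq_0_disj by auto
  then show ?case
    using p'(3) r by (intro exI[of _ "case_nat p r"]) (simp add: ex)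
qed auto

text \<open>Two words with equivalent factorizations carry runs through the same states at the
  factor boundaries, with the same information on which factors visit an accepting state.\<close>

lemma buchi_accepts_same_factors:
  assumes acc: "buchi_accepts Q I D F w"
    and f: "strict_mono f" "f 0 = 0" and g: "strict_mono g" "g 0 = 0"
    and eq: "\<And>n p q b. p \<in> Q \<Longrightarrow> path D F p (seg w (f n) (f (Suc n))) q b \<Longrightarrow>
                       path D F p (seg w' (g n) (g (Suc n))) q b"
    and D: "D \<subseteq> Q \<times> UNIV \<times> Q"
  shows "buchi_accepts Q I D F w'"
proof -
  obtain r where r: "r 0 \<in> I" "\<And>n. (r n, w n, r (Suc n)) \<in> D" "\<exists>\<^sub>\<infinity>n. r n \<in> F"
    using acc unfolding buchi_accepts_def by blast
  define b where "b n \<longleftrightarrow> (\<exists>m<f (Suc n) - f n. r (Suc (f n + m)) \<in> F)" for n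
  have fS: "f n < f (Suc n)" "g n < g (Suc n)" for n
    using f g by (simp_all add: strict_mono_Suc_iff)
  have "path D F (r (f n)) (seg w (f n) (f (Suc n))) (r (f (Suc n))) (b n)" for n
    using path_of_run[of "seg w (f n) (f (Suc n))" "\<lambda>m. r (f n + m)" D F] r(2) fS(1)[of n]
    by (simp add: b_def)
  moreover have "r n \<in> Q" for n using r(2)[of n] D by blast
  ultimately have "path D F (r (f n)) (seg w' (g n) (g (Suc n))) (r (f (Suc n))) (b n)" for n
    using eq by blast
  from run_of_path[OF this] obtain \<rho> where \<rho>:
    "\<And>n. \<rho> n 0 = r (f n)" "\<And>n. \<rho> n (g (Suc n) - g n) = r (f (Suc n))"
    "\<And>n m. m < g (Suc n) - g n \<Longrightarrow> (\<rho> n m, w' (g n + m), \<rho> n (Suc m)) \<in> D"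
    "\<And>n. b n \<longleftrightarrow> (\<exists>m<g (Suc n) - g n. \<rho> n (Suc m) \<in> F)"
    by simp metis
  obtain k where k: "\<And>x. g (k x) \<le> x" "\<And>x. x < g (Suc (k x))"
    using strict_mono_interval[OF g(1)] g(2) by (metis le0)
  define r' where "r' x = \<rho> (k x) (x - g (k x))" for x
  have k_eq: "k x = n" if "g n \<le> x" "x < g (Suc n)" for x n
    using strict_mono_interval_unique[OF g(1) that k] .
  have r'1: "r' x = \<rho> n (x - g n)" if "g n \<le> x" "x < g (Suc n)" for x n
    using k_eq[OF that] by (simp add: r'_def)
  \<comment> \<open>Both ends of a factor are allowed, because \<open>\<rho> n\<close> ends where
    \<open>\<rho> (Suc n)\<close> begins; thus every transition of \<open>r'\<close> lies within one
    factor.\<close>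
  have r': "r' x = \<rho> n (x - g n)" if x: "g n \<le> x" "x \<le> g (Suc n)" for x n
  proof (cases "x = g (Suc n)")
    case True
    then show ?thesis using r'1[of "Suc n" x] fS(2)[of "Suc n"] \<rho>(1,2) by simp
  next
    case False
    then show ?thesis using r'1 x by simp
  qed
  show ?thesis
    unfolding buchi_accepts_def
  proof (intro exI conjI allI)
    show "r' 0 \<in> I" using r'[of 0 0] f(2) g(2) \<rho>(1) r(1) by simp
  next
    fix x
    show "(r' x, w' x, r' (Suc x)) \<in> D"
      using k[of x] r'[of "k x" x] r'[of "k x" "Suc x"] \<rho>(3)[of "x - g (k x)" "k x"]
      by (simp add: Suc_diff_le)
  next
    show "\<exists>\<^sub>\<infinity>n. r' n \<in> F"
      unfolding INFM_nat
    proof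
      fix m
      obtain y where y: "y > f m" "r y \<in> F" using r(3) unfolding INFM_nat by blast
      \<comment> \<open>An accepting state at \<open>y\<close> counts for the factor containing the
        predecessor \<open>z\<close>, since start states of factors are excluded from the
        bit.\<close>
      then obtain z where z: "y = Suc z" "f m \<le> z" by (cases y) auto
      obtain n where n: "f n \<le> z" "z < f (Suc n)" using strict_mono_interval[OF f(1), of z] f(2) by auto
      have "m \<le> n" using z(2) n(2) f(1) by (meson le_less_trans less_Suc_eq_le strict_mono_less)
      have "b n" unfolding b_def using n y z by (intro exI[of _ "z - f n"]) auto
      then obtain i where i: "i < g (Suc n) - g n" "\<rho> n (Suc i) \<in> F" using \<rho>(4) by blast
      have "r' (Suc (g n + i)) \<in> F" using r'[of n "Suc (g n + i)"] i by simp
      moreover have "m \<le> g n" using \<open>m \<le> n\<close> strict_mono_imp_increasing[OF g(1), of n] by simp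
      ultimately show "\<exists>n>m. r' n \<in> F" by (intro exI[of _ "Suc (g n + i)"]) auto
    qed
  qed
qed

text \<open>Buchi's transition profiles: \<open>\<phi> u\<close> lists the pairs of states joined by
  a path over \<open>u\<close>, each with its bit, and concatenation of words composes profiles.
  Restricting \<open>p\<close> to \<open>Q\<close> keeps profiles inside a finite set, as the empty
  word joins every number to itself.\<close>

lemma omega_regular_recognized:
  assumes "omega_regular X"
  obtains \<phi> :: "'v list \<Rightarrow> (nat \<times> nat \<times> bool) set" where "finite_congruence \<phi>" "recognizes \<phi> X"
proof -
  obtain Q I D F where A: "finite Q" "I \<subseteq> Q" "D \<subseteq> Q \<times> UNIV \<times> Q" "X = {w. buchi_accepts Q I D F w}"
    using assms unfolding omega_regular_def by blast
  define \<phi> where "\<phi> u = {(p, q, b). p \<in> Q \<and> path D F p u q b}" for u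
  have "\<phi> u \<subseteq> Q \<times> Q \<times> UNIV" for u
    unfolding \<phi>_def using path_closed[OF _ A(3)] by blast
  then have "range \<phi> \<subseteq> Pow (Q \<times> Q \<times> UNIV)" by blast
  then have "finite (range \<phi>)"
    by (rule finite_subset) (use A(1) in simp)
  moreover have "\<phi> (u @ v) = {(p, q, b). \<exists>s b1 b2. (p, s, b1) \<in> \<phi> u \<and> (s, q, b2) \<in> \<phi> v \<and> b = (b1 \<or> b2)}" for u v
    unfolding \<phi>_def path_append using path_closed[OF _ A(3)] by blast
  ultimately have "finite_congruence \<phi>" unfolding finite_congruence_def by simp
  moreover have "recognizes \<phi> X"
    unfolding recognizes_def
  proof (intro allI impI)
    fix w w' assume "same_factors \<phi> w w'" and w: "w \<in> X"
    then obtain f g where f: "strict_mono f" "f 0 = 0" and g: "strict_mono g" "g 0 = 0"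
      and eq: "\<And>n. \<phi> (seg w (f n) (f (Suc n))) = \<phi> (seg w' (g n) (g (Suc n)))"
      unfolding same_factors_def by blast
    have "path D F p (seg w' (g n) (g (Suc n))) q b"
      if "p \<in> Q" "path D F p (seg w (f n) (f (Suc n))) q b" for n p q b
    proof -
      have "(p, q, b) \<in> \<phi> (seg w (f n) (f (Suc n)))" using that unfolding \<phi>_def by simp
      then have "(p, q, b) \<in> \<phi> (seg w' (g n) (g (Suc n)))" by (simp only: eq)
      then show ?thesis unfolding \<phi>_def by simp
    qed
    moreover have "buchi_accepts Q I D F w" using w A(4) by simp
    ultimately have "buchi_accepts Q I D F w'"
      using buchi_accepts_same_factors[OF _ f g _ A(3)] by blast
    then show "w' \<in> X" using A(4) by simp
  qed
  ultimately show ?thesis using that by blast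
qed

lemma recognizes_refine:
  assumes "\<And>u v. \<phi> u = \<phi> v \<Longrightarrow> \<psi> u = \<psi> v" "recognizes \<psi> X"
  shows "recognizes \<phi> X"
  using assms unfolding recognizes_def same_factors_def by blast

text \<open>A list of profiles serves as the product of the congruences, because the number of
  languages is not fixed by a type.\<close>

lemma finite_omega_regular_recognized:
  assumes "finite \<X>" "\<And>X. X \<in> \<X> \<Longrightarrow> omega_regular X"
  shows "\<exists>\<phi> :: 'v list \<Rightarrow> (nat \<times> nat \<times> bool) set list. finite_congruence \<phi> \<and> (\<forall>X\<in>\<X>. recognizes \<phi> X)"
  using assms
proof (induction \<X> rule: finite_induct)
  case empty
  show ?case by (intro exI[of _ "\<lambda>_. []"]) (auto simp: finite_congruence_def)
next
  case (insert X \<X>)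
  then obtain \<phi> :: "'v list \<Rightarrow> (nat \<times> nat \<times> bool) set list"
    where \<phi>: "finite_congruence \<phi>" "\<And>X. X \<in> \<X> \<Longrightarrow> recognizes \<phi> X" by blast
  obtain \<psi> :: "'v list \<Rightarrow> (nat \<times> nat \<times> bool) set" where \<psi>: "finite_congruence \<psi>" "recognizes \<psi> X"
    using omega_regular_recognized insert.prems by blast
  have "range (\<lambda>u. \<psi> u # \<phi> u) \<subseteq> (\<lambda>(x, y). x # y) ` (range \<psi> \<times> range \<phi>)" by auto
  then have "finite (range (\<lambda>u. \<psi> u # \<phi> u))"
    by (rule finite_subset)
      (use \<phi>(1) \<psi>(1) in \<open>unfold finite_congruence_def, blast\<close>)
  then have "finite_congruence (\<lambda>u. \<psi> u # \<phi> u)"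
    using \<phi>(1) \<psi>(1) unfolding finite_congruence_def list.inject by blast
  moreover have "recognizes (\<lambda>u. \<psi> u # \<phi> u) Y" if "Y \<in> insert X \<X>" for Y
    using that \<phi>(2) \<psi>(2) recognizes_refine[of "\<lambda>u. \<psi> u # \<phi> u" \<psi>] recognizes_refine[of "\<lambda>u. \<psi> u # \<phi> u" \<phi>]
    by auto
  ultimately show ?case by blast
qed

section \<open>Determinization\<close>

text \<open>This gives the stability of indices: an entry moves only when an entry before it is
  dropped.\<close>

lemma nths_nth_prefix:
  assumes "a < length xs" "\<And>i. i \<le> a \<Longrightarrow> i \<in> A"
  shows "a < length (nths xs A)" "nths xs A ! a = xs ! a"
proof -
  have "nths (take (Suc a) xs) A = take (Suc a) xs"
    using assms by (intro nths_all) auto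
  then obtain zs where "nths xs A = take (Suc a) xs @ zs"
    using nths_append[of "take (Suc a) xs" "drop (Suc a) xs" A] by auto
  moreover have "length (take (Suc a) xs) = Suc a" using assms(1) by simp
  ultimately show "a < length (nths xs A)" "nths xs A ! a = xs ! a"
    by (simp_all add: nth_append)
qed

lemma seg_append: "i \<le> j \<Longrightarrow> j \<le> k \<Longrightarrow> seg w i j @ seg w j k = seg w i k"
  by (metis le_add_diff_inverse map_append upt_add_eq_append)

text \<open>An entry belongs to a position \<open>t\<close> of the word: the value of the suffix
  from \<open>t\<close>, and a row with the values of the factors from all tracked positions to
  \<open>t\<close>. When \<open>t\<close> is absorbed by an older position, the row supplies the
  value of the factor between them. Column \<open>0\<close>, which always belongs to position
  \<open>0\<close>, supplies the value of the prefix before \<open>t\<close>.\<close>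

type_synonym 'm tracker = "('m \<times> 'm list) list"

definition survivors :: "'m tracker \<Rightarrow> nat set" where
  "survivors q = {b. b < length q \<and> (\<forall>a<b. fst (q ! a) \<noteq> fst (q ! b))}"

definition merges :: "'m tracker \<Rightarrow> nat \<Rightarrow> nat \<Rightarrow> bool" where
  "merges q b a \<longleftrightarrow> a \<in> survivors q \<and> a < b \<and> b < length q \<and> fst (q ! a) = fst (q ! b)"

definition prune :: "'m tracker \<Rightarrow> 'm tracker" where
  "prune q = nths (map (\<lambda>(y, row). (y, nths row (survivors q))) q) (survivors q)"

text \<open>Priorities for the min-parity condition, where even is good: dropping the entry at index
  \<open>b\<close> emits \<open>2b + 1\<close>, a favourable merge into index \<open>a\<close> emits \<open>2a + 2\<close>, and the inserted
  odd value is a default larger than the priority of any dropped entry.\<close>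

definition emissions :: "('m \<times> 'm) set \<Rightarrow> 'm tracker \<Rightarrow> nat set" where
  "emissions G q = insert (2 * length q + 1)
     ({2 * b + 1 | b. b < length q \<and> b \<notin> survivors q} \<union>
      {2 * a + 2 | a b. merges q b a \<and> (snd (q ! a) ! 0, snd (q ! b) ! a) \<in> G})"

lemma finite_emissions: "finite (emissions G q)"
proof -
  have "emissions G q \<subseteq> {..2 * length q + 2}"
    unfolding emissions_def merges_def by auto
  then show ?thesis by (rule finite_subset) simp
qed

lemma merges_if_dead:
  assumes "b < length q" "b \<notin> survivors q"
  shows "\<exists>a. merges q b a"
proof -
  have "\<exists>a. a < b \<and> fst (q ! a) = fst (q ! b)" using assms unfolding survivors_def by auto
  then obtain a where a: "a < b" "fst (q ! a) = fst (q ! b)"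
    "\<And>c. c < a \<Longrightarrow> \<not> (c < b \<and> fst (q ! c) = fst (q ! b))"
    using exists_least_iff[of "\<lambda>a. a < b \<and> fst (q ! a) = fst (q ! b)"] by blast
  then have "merges q b a" using assms unfolding merges_def survivors_def by auto
  then show ?thesis by blast
qed

lemma zero_survives: "q \<noteq> [] \<Longrightarrow> 0 \<in> survivors q"
  by (simp add: survivors_def)

locale word_congruence =
  fixes \<phi> :: "'v list \<Rightarrow> 'm"
  assumes finite_range: "finite (range \<phi>)"
    and cong: "\<phi> u = \<phi> u' \<Longrightarrow> \<phi> v = \<phi> v' \<Longrightarrow> \<phi> (u @ v) = \<phi> (u' @ v')"
begin

text \<open>The product induced on the values; by \<open>cong\<close> the representatives picked by
  \<open>inv\<close> do not matter.\<close>

definition mul :: "'m \<Rightarrow> 'm \<Rightarrow> 'm" where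
  "mul x y = \<phi> (inv \<phi> x @ inv \<phi> y)"

lemma mul: "mul (\<phi> u) (\<phi> v) = \<phi> (u @ v)"
  unfolding mul_def by (rule cong; rule f_inv_into_f; rule rangeI)

text \<open>The new position starts behind \<open>x\<close>, so its row consists of the advanced
  suffix values of the older positions. In the older rows its column is \<open>\<phi> []\<close>,
  the value of a segment \<open>seg w i j\<close> with \<open>j < i\<close>.\<close>

definition extend :: "'m tracker \<Rightarrow> 'v \<Rightarrow> 'm tracker" where
  "extend q x = map (\<lambda>(y, row). (mul y (\<phi> [x]), row @ [\<phi> []])) q @
     [(\<phi> [], map (\<lambda>(y, row). mul y (\<phi> [x])) q @ [\<phi> []])]"

definition step :: "'m tracker \<Rightarrow> 'v \<Rightarrow> 'm tracker" where
  "step q x = prune (extend q x)"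

definition init :: "'m tracker" where
  "init = [(\<phi> [], [\<phi> []])]"

text \<open>The priority is taken before pruning, while the merging pairs are still present.\<close>

definition priority :: "('m \<times> 'm) set \<Rightarrow> 'v \<times> 'm tracker \<Rightarrow> nat" where
  "priority G = (\<lambda>(x, q). Min (emissions G (extend q x)))"

section \<open>The tracker of an infinite word\<close>

definition encode :: "(nat \<Rightarrow> 'v) \<Rightarrow> nat \<Rightarrow> nat list \<Rightarrow> 'm tracker" where
  "encode w k ts = map (\<lambda>t. (\<phi> (seg w t k), map (\<lambda>t'. \<phi> (seg w t' t)) ts)) ts"

lemma length_encode [simp]: "length (encode w k ts) = length ts"
  by (simp add: encode_def)

lemma encode_nth [simp]:
  "i < length ts \<Longrightarrow> encode w k ts ! i = (\<phi> (seg w (ts ! i) k), map (\<lambda>t'. \<phi> (seg w t' (ts ! i))) ts)"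
  by (simp add: encode_def)

lemma extend_encode:
  assumes "\<And>t. t \<in> set ts \<Longrightarrow> t \<le> k"
  shows "extend (encode w k ts) (w k) = encode w (Suc k) (ts @ [Suc k])"
proof -
  have "t \<le> Suc k" if "t \<in> set ts" for t using assms[OF that] by simp
  moreover have "\<phi> (seg w t k @ [w k]) = \<phi> (seg w t (Suc k))" if "t \<in> set ts" for t
    using assms[OF that] by simp
  ultimately show ?thesis by (simp add: extend_def encode_def mul upt_conv_Nil del: upt_Suc)
qed

lemma prune_encode:
  "prune (encode w k ts) = encode w k (nths ts (survivors (encode w k ts)))"
  by (simp add: prune_def encode_def nths_map)

text \<open>Positions of the word whose suffixes have pairwise different values, oldest first:
  when two suffixes get the same value, they keep it forever, and the younger one is dropped.\<close>

fun threads :: "(nat \<Rightarrow> 'v) \<Rightarrow> nat \<Rightarrow> nat list" where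
  "threads w 0 = [0]"
| "threads w (Suc k) =
     nths (threads w k @ [Suc k]) (survivors (encode w (Suc k) (threads w k @ [Suc k])))"

definition candidates :: "(nat \<Rightarrow> 'v) \<Rightarrow> nat \<Rightarrow> nat list" where
  "candidates w k = threads w k @ [Suc k]"

definition tracker :: "(nat \<Rightarrow> 'v) \<Rightarrow> nat \<Rightarrow> 'm tracker" where
  "tracker w k = encode w (Suc k) (candidates w k)"

lemma threads_Suc: "threads w (Suc k) = nths (candidates w k) (survivors (tracker w k))"
  by (simp add: candidates_def tracker_def)

lemma length_candidates: "length (candidates w k) = Suc (length (threads w k))"
  by (simp add: candidates_def)

lemma length_tracker [simp]: "length (tracker w k) = length (candidates w k)"
  by (simp add: tracker_def)

lemma threads_le: "t \<in> set (threads w k) \<Longrightarrow> t \<le> k"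
proof (induction k)
  case (Suc k)
  have "t \<in> set (candidates w k)" using Suc.prems unfolding threads_Suc by (rule in_set_nthsD)
  then show ?case using Suc.IH by (auto simp: candidates_def)
qed simp

lemma candidates_le: "t \<in> set (candidates w k) \<Longrightarrow> t \<le> Suc k"
  using threads_le unfolding candidates_def by fastforce

lemma threads_sorted: "sorted (threads w k) \<and> distinct (threads w k)"
proof (induction k)
  case (Suc k)
  then have "sorted (candidates w k) \<and> distinct (candidates w k)"
    using threads_le[of _ w k] unfolding candidates_def by (force simp: sorted_append)
  then show ?case unfolding threads_Suc using sorted_nths distinct_nthsI by blast
qed simp

lemma candidates_sorted: "sorted (candidates w k)" "distinct (candidates w k)"
  using threads_sorted[of w k] threads_le[of _ w k] unfolding candidates_def
  by (force simp: sorted_append)+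

lemma candidates_less: "a < b \<Longrightarrow> b < length (candidates w k) \<Longrightarrow> candidates w k ! a < candidates w k ! b"
  using candidates_sorted[of w k] by (meson strict_sorted_iff sorted_wrt_nth_less)

lemma threads_0: "0 < length (threads w k) \<and> threads w k ! 0 = 0"
proof (induction k)
  case (Suc k)
  have "tracker w k \<noteq> []" using length_tracker[of w k] length_candidates[of w k] by force
  then have "0 \<in> survivors (tracker w k)" by (rule zero_survives)
  then show ?case
    unfolding threads_Suc using Suc nths_nth_prefix[of 0 "candidates w k" "survivors (tracker w k)"]
    by (simp add: candidates_def nth_append)
qed simp

lemma candidates_0: "candidates w k ! 0 = 0"
  using threads_0[of w k] by (simp add: candidates_def nth_append)

lemma state_eq: "foldl step init (seg w 0 k) = encode w k (threads w k)"
proof (induction k)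
  case 0
  show ?case by (simp add: init_def encode_def)
next
  case (Suc k)
  then show ?case
    by (simp add: step_def extend_encode threads_le prune_encode)
qed

lemma priority_eq:
  "priority G (w k, foldl step init (seg w 0 k)) = Min (emissions G (tracker w k))"
  unfolding priority_def state_eq by (simp add: extend_encode threads_le tracker_def candidates_def)

lemma length_threads: "length (threads w k) \<le> card (range \<phi>)"
proof (cases k)
  case 0
  then show ?thesis using finite_range by (simp add: Suc_le_eq card_gt_0_iff)
next
  case (Suc j)
  let ?A = "survivors (tracker w j)"
  have sub: "?A \<subseteq> {..<length (candidates w j)}" unfolding survivors_def by auto
  then have "length (threads w k) = card ?A"
    unfolding Suc threads_Suc length_nths by (intro arg_cong[of _ _ card]) auto
  also have "\<dots> \<le> card (range \<phi>)"
  proof (rule card_inj_on_le[of "\<lambda>i. fst (tracker w j ! i)"])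
    show "inj_on (\<lambda>i. fst (tracker w j ! i)) ?A"
      unfolding survivors_def by (auto intro!: linorder_inj_onI)
    show "(\<lambda>i. fst (tracker w j ! i)) ` ?A \<subseteq> range \<phi>"
      using sub by (auto simp: tracker_def)
  qed (rule finite_range)
  finally show ?thesis .
qed

lemma finite_states: "finite (range (foldl step init))"
proof -
  let ?R = "{ys. set ys \<subseteq> range \<phi> \<and> length ys \<le> card (range \<phi>)}"
  let ?Q = "{q. set q \<subseteq> range \<phi> \<times> ?R \<and> length q \<le> card (range \<phi>)}"
  have "foldl step init u \<in> ?Q" for u
  proof -
    \<comment> \<open>A finite word is read as a prefix of the infinite word \<open>(!) u\<close>,
      whose tail is arbitrary.\<close>
    have "u = seg ((!) u) 0 (length u)" by (simp add: map_nth)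
    then have "foldl step init u = encode ((!) u) (length u) (threads ((!) u) (length u))"
      using state_eq by metis
    then show ?thesis
      using length_threads[of "(!) u" "length u"] by (auto simp: encode_def)
  qed
  then have "range (foldl step init) \<subseteq> ?Q" by blast
  moreover have "finite ?Q"
    using finite_range by (intro finite_lists_length_le finite_cartesian_product)
  ultimately show ?thesis by (rule finite_subset)
qed

section \<open>Deaths, merges and the factorizations they induce\<close>

definition dead :: "(nat \<Rightarrow> 'v) \<Rightarrow> nat \<Rightarrow> nat \<Rightarrow> bool" where
  "dead w k b \<longleftrightarrow> b < length (candidates w k) \<and> b \<notin> survivors (tracker w k)"

lemma dead_merges: "dead w k b \<Longrightarrow> \<exists>a. merges (tracker w k) b a"
  unfolding dead_def using merges_if_dead[of b "tracker w k"] by simp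

lemma merges_dead: "merges (tracker w k) b a \<Longrightarrow> dead w k b"
  unfolding merges_def dead_def survivors_def by auto

text \<open>Every step adds one candidate, while at most \<open>card (range \<phi>)\<close> of them
  survive.\<close>

lemma infinitely_many_deaths: "\<exists>\<^sub>\<infinity>k. \<exists>b. dead w k b"
proof (rule ccontr)
  assume "\<not> ?thesis"
  then obtain N where N: "\<And>k b. k \<ge> N \<Longrightarrow> \<not> dead w k b" unfolding INFM_nat_le by blast
  have grow: "length (threads w (Suc k)) = Suc (length (threads w k))" if "k \<ge> N" for k
  proof -
    have "nths (candidates w k) (survivors (tracker w k)) = candidates w k"
      using N[OF that] unfolding dead_def by (intro nths_all) auto
    then show ?thesis by (simp only: threads_Suc length_candidates)
  qed
  have "length (threads w (N + n)) \<ge> n" for n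
    by (induction n) (use grow in \<open>auto simp del: threads.simps\<close>)
  from this[of "Suc (card (range \<phi>))"] show False
    using length_threads[of w "N + Suc (card (range \<phi>))"] by simp
qed

lemma stable_thread:
  assumes "\<And>k i. k \<ge> N \<Longrightarrow> i \<le> a \<Longrightarrow> \<not> dead w k i" "a < length (threads w N)" "k \<ge> N"
  shows "a < length (threads w k) \<and> threads w k ! a = threads w N ! a"
  using assms(3)
proof (induction k rule: dec_induct)
  case (step k)
  have "\<And>i. i \<le> a \<Longrightarrow> i \<in> survivors (tracker w k)"
    using assms(1)[OF step(1)] step(3) unfolding dead_def length_candidates by auto
  moreover have "a < length (candidates w k)" "candidates w k ! a = threads w k ! a"
    using step(3) by (simp_all add: candidates_def nth_append)
  ultimately show ?case
    unfolding threads_Suc using nths_nth_prefix[of a "candidates w k" "survivors (tracker w k)"] step(3)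
    by simp
qed (use assms(2) in simp)

text \<open>The first factor includes one \<open>e\<close>, so that it is nonempty even when
  \<open>s\<close> is the value of the empty prefix.\<close>

definition factors :: "(nat \<Rightarrow> 'v) \<Rightarrow> 'm \<Rightarrow> 'm \<Rightarrow> bool" where
  "factors w s e \<longleftrightarrow> (\<exists>f. strict_mono f \<and> f 0 = 0 \<and> \<phi> (seg w 0 (f 1)) = mul s e \<and>
     (\<forall>n\<ge>1. \<phi> (seg w (f n) (f (Suc n))) = e))"

lemma factors_same: "factors w s e \<Longrightarrow> factors w' s e \<Longrightarrow> same_factors \<phi> w w'"
proof -
  assume "factors w s e" "factors w' s e"
  then obtain f g where f: "strict_mono f" "f 0 = 0" "\<phi> (seg w 0 (f 1)) = mul s e"
      "\<forall>n\<ge>1. \<phi> (seg w (f n) (f (Suc n))) = e"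
    and g: "strict_mono g" "g 0 = 0" "\<phi> (seg w' 0 (g 1)) = mul s e"
      "\<forall>n\<ge>1. \<phi> (seg w' (g n) (g (Suc n))) = e"
    unfolding factors_def by blast
  have "\<phi> (seg w (f n) (f (Suc n))) = \<phi> (seg w' (g n) (g (Suc n)))" for n
    using f(2-4) g(2-4) by (cases n) simp_all
  then show ?thesis unfolding same_factors_def using f(1,2) g(1,2) by blast
qed

lemma seg_cong_append:
  assumes "\<phi> (seg w i k) = \<phi> (seg w j k)" "i \<le> k" "j \<le> k" "k \<le> l"
  shows "\<phi> (seg w i l) = \<phi> (seg w j l)"
  using cong[OF assms(1) refl, of "seg w k l"] assms by (simp only: seg_append)

text \<open>Once the suffixes from \<open>t\<close> and \<open>j\<close> agree in value at
  \<open>d\<close>, they agree forever. With \<open>j 0 \<le> d 0 < j 1 \<le> d 1 < ...\<close> the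
  factor from \<open>j m\<close> to \<open>j (Suc m)\<close> has the value of the factor from
  \<open>t\<close> to \<open>j (Suc m)\<close>, which is \<open>e\<close>. Merging thus takes the
  place of Ramsey's theorem.\<close>

lemma factors_if_merging:
  assumes merging: "\<And>n. \<exists>j d. n \<le> j \<and> t < j \<and> j \<le> d \<and> \<phi> (seg w t j) = e \<and> \<phi> (seg w t d) = \<phi> (seg w j d)"
  shows "factors w (\<phi> (seg w 0 t)) e"
proof -
  let ?P = "\<lambda>(j, d). t < j \<and> j \<le> d \<and> \<phi> (seg w t j) = e \<and> \<phi> (seg w t d) = \<phi> (seg w j d)"
  have "\<exists>f. \<forall>n::nat. ?P (f n) \<and> snd (f n) < fst (f (Suc n))"
  proof (rule dependent_nat_choice)
    show "\<exists>x. ?P x" using merging[of 0] by auto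
  next
    fix x :: "nat \<times> nat" and n :: nat
    show "\<exists>y. ?P y \<and> snd x < fst y" using merging[of "Suc (snd x)"] by (auto simp: Suc_le_eq)
  qed
  then obtain f where f: "\<forall>n. ?P (f n) \<and> snd (f n) < fst (f (Suc n))" ..
  define j where "j n = fst (f n)" for n
  define d where "d n = snd (f n)" for n
  have P: "t < j n" "j n \<le> d n" "\<phi> (seg w t (j n)) = e" "\<phi> (seg w t (d n)) = \<phi> (seg w (j n) (d n))"
    "d n < j (Suc n)" for n
    using f[rule_format, of n] unfolding j_def d_def case_prod_beta by blast+
  define g where "g = case_nat 0 j"
  have "strict_mono g"
    unfolding strict_mono_Suc_iff
  proof
    fix n
    show "g n < g (Suc n)" using P[of "n - 1"] P(1)[of 0] by (cases n) (simp_all add: g_def)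
  qed
  moreover have "\<phi> (seg w 0 (g 1)) = mul (\<phi> (seg w 0 t)) e"
    using P(1)[of 0] seg_append[of 0 t "j 0" w] by (simp add: g_def mul flip: P(3)[of 0])
  moreover have "\<phi> (seg w (g n) (g (Suc n))) = e" if "n \<ge> 1" for n
  proof -
    obtain m where m: "n = Suc m" using \<open>n \<ge> 1\<close> by (cases n) auto
    have "\<phi> (seg w t (j (Suc m))) = \<phi> (seg w (j m) (j (Suc m)))"
      using P(1,2,5)[of m] by (intro seg_cong_append[OF P(4)[of m]]) linarith+
    then show ?thesis unfolding m g_def using P(3)[of "Suc m"] by simp
  qed
  ultimately show ?thesis unfolding factors_def by (intro exI[of _ g]) (simp add: g_def)
qed

lemma dead_not_later:
  assumes "dead w k b" "k < k'"
  shows "candidates w k ! b \<notin> set (candidates w k')"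
proof -
  let ?j = "candidates w k ! b"
  have b: "b < length (candidates w k)" "b \<notin> survivors (tracker w k)"
    using assms(1) unfolding dead_def by auto
  have j: "?j \<le> Suc k" using candidates_le nth_mem[OF b(1)] by blast
  have "?j \<notin> set (threads w k')" if "k' \<ge> Suc k" for k'
    using that
  proof (induction k' rule: dec_induct)
    case base
    show ?case
      unfolding threads_Suc set_nths using b candidates_sorted(2)[of w k]
      by (auto simp: nth_eq_iff_index_eq)
  next
    case (step m)
    then have "?j \<notin> set (candidates w m)" using j by (auto simp: candidates_def)
    then show ?case unfolding threads_Suc by (rule notin_set_nthsI)
  qed
  then show ?thesis using assms(2) j by (auto simp: candidates_def)
qed

text \<open>Dropped positions never return, so each merge into \<open>a\<close> drops another one.
  Infinitely many merges therefore involve arbitrarily late positions, as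
  \<open>factors_if_merging\<close> demands.\<close>

lemma factors_if_stable:
  assumes stable: "\<And>k. k \<ge> N \<Longrightarrow> a < length (threads w k) \<and> threads w k ! a = t"
    and inf: "\<exists>\<^sub>\<infinity>k. \<exists>b. merges (tracker w k) b a \<and> snd (tracker w k ! b) ! a = e"
  shows "factors w (\<phi> (seg w 0 t)) e"
proof (rule factors_if_merging)
  fix n
  define S where "S = {k. k \<ge> N \<and> (\<exists>b. merges (tracker w k) b a \<and> snd (tracker w k ! b) ! a = e)}"
  have "infinite S"
    unfolding S_def infinite_nat_iff_unbounded_le
    using inf unfolding INFM_nat_le by (metis (mono_tags, lifting) le_trans linorder_le_cases mem_Collect_eq)
  have "\<forall>k\<in>S. \<exists>b. merges (tracker w k) b a \<and> snd (tracker w k ! b) ! a = e"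
    unfolding S_def by simp
  from bchoice[OF this] obtain B
    where B: "\<And>k. k \<in> S \<Longrightarrow> merges (tracker w k) (B k) a \<and> snd (tracker w k ! B k) ! a = e"
    by blast
  define J where "J k = candidates w k ! B k" for k
  have BJ: "B k < length (candidates w k)" "dead w k (B k)" if "k \<in> S" for k
    using B[OF that] merges_dead unfolding merges_def by auto
  have "J k \<noteq> J k'" if "k \<in> S" "k' \<in> S" "k < k'" for k k'
    using dead_not_later[OF BJ(2)[OF that(1)] that(3)] nth_mem[OF BJ(1)[OF that(2)]]
    unfolding J_def by metis
  then have "inj_on J S" by (intro linorder_inj_onI) auto
  then have "infinite (J ` S)" using \<open>infinite S\<close> finite_imageD by blast
  then obtain k where k: "k \<in> S" "n \<le> J k"
    unfolding infinite_nat_iff_unbounded_le by blast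
  have a: "a < B k" "fst (tracker w k ! a) = fst (tracker w k ! B k)" using B[OF k(1)] unfolding merges_def by auto
  have ca: "candidates w k ! a = t"
    using k(1) stable[of k] unfolding S_def candidates_def by (simp add: nth_append)
  have "t < J k" using candidates_less[OF a(1) BJ(1)[OF k(1)]] ca unfolding J_def by simp
  moreover have "J k \<le> Suc k" using candidates_le nth_mem[OF BJ(1)[OF k(1)]] unfolding J_def by blast
  moreover have "\<phi> (seg w t (J k)) = e" "\<phi> (seg w t (Suc k)) = \<phi> (seg w (J k) (Suc k))"
    using B[OF k(1)] a BJ(1)[OF k(1)] ca by (simp_all add: tracker_def J_def)
  ultimately show "\<exists>j d. n \<le> j \<and> t < j \<and> j \<le> d \<and> \<phi> (seg w t j) = e \<and> \<phi> (seg w t d) = \<phi> (seg w j d)"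
    using k(2) by blast
qed

section \<open>Correctness of the parity condition\<close>

definition accepting :: "(nat \<Rightarrow> 'v) set \<Rightarrow> ('m \<times> 'm) set" where
  "accepting X = {(s, e). \<exists>w\<in>X. factors w s e}"

lemma accepting_iff:
  assumes "recognizes \<phi> X" "factors w s e"
  shows "(s, e) \<in> accepting X \<longleftrightarrow> w \<in> X"
  using assms factors_same unfolding recognizes_def accepting_def by blast

lemma tracker_row:
  assumes "a < length (candidates w k)" "b < length (candidates w k)"
  shows "snd (tracker w k ! b) ! a = \<phi> (seg w (candidates w k ! a) (candidates w k ! b))"
  using assms by (simp add: tracker_def)

text \<open>A favourable merge into \<open>a\<close>, of priority \<open>2a + 2\<close>, is
  overruled by deaths at indices up to \<open>a\<close> and overrules all deaths at larger ones. If
  \<open>2a + 2\<close> is the least recurring priority, the thread at \<open>a\<close> is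
  eventually fixed and absorbs forever. Conversely, the least index \<open>b\<close> that dies
  infinitely often merges infinitely often into one fixed \<open>a < b\<close> across one value
  \<open>e\<close>, and for \<open>w\<close> in \<open>X\<close> these merges are
  favourable.\<close>

theorem parity_automaton:
  assumes X: "recognizes \<phi> X"
  shows "parity_wins (priority (accepting X)) (w \<in> X) (\<lambda>k. (w k, foldl step init (seg w 0 k)))"
proof -
  let ?G = "accepting X"
  define p where "p k = Min (emissions ?G (tracker w k))" for k
  have p_le: "p k \<le> x" if "x \<in> emissions ?G (tracker w k)" for k x
    unfolding p_def using that finite_emissions by (rule Min_le[rotated])
  have p_in: "p k \<in> emissions ?G (tracker w k)" for k
    unfolding p_def using finite_emissions by (intro Min_in) (auto simp: emissions_def)
  have "p k \<le> 2 * Suc (card (range \<phi>)) + 1" for k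
    using p_le[of "2 * length (tracker w k) + 1" k] length_threads[of w k]
    unfolding emissions_def length_tracker length_candidates by simp
  from liminf_nat[OF this] obtain m where m: "\<exists>\<^sub>\<infinity>k. p k = m" "\<forall>\<^sub>\<infinity>k. m \<le> p k" .
  have "even m \<longleftrightarrow> w \<in> X"
  proof
    assume "even m"
    define good where "good a k e \<longleftrightarrow> (\<exists>b. merges (tracker w k) b a \<and> snd (tracker w k ! b) ! a = e \<and>
        (snd (tracker w k ! a) ! 0, e) \<in> ?G)" for a k e
    have "\<exists>a e. m = 2 * a + 2 \<and> good a k e" if "p k = m" for k
      using p_in[of k] \<open>even m\<close> unfolding that emissions_def good_def by auto
    moreover obtain k0 where "p k0 = m" using m(1) INFM_EX by blast
    ultimately obtain a where a: "m = 2 * a + 2" by blast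
    have "\<exists>\<^sub>\<infinity>k. \<exists>e\<in>range \<phi>. good a k e"
      using m(1)
    proof (rule INFM_mono)
      fix k assume "p k = m"
      then obtain e b where "good a k e" "merges (tracker w k) b a" "snd (tracker w k ! b) ! a = e"
        using \<open>\<And>k. p k = m \<Longrightarrow> _\<close>[of k] a unfolding good_def by auto
      moreover from this have "e \<in> range \<phi>"
        using tracker_row[of a w k b] unfolding merges_def by auto
      ultimately show "\<exists>e\<in>range \<phi>. good a k e" by blast
    qed
    from frequently_bex_finite[OF finite_range this] obtain e where e: "\<exists>\<^sub>\<infinity>k. good a k e"
      by blast
    obtain N0 where N0: "\<And>k. k \<ge> N0 \<Longrightarrow> m \<le> p k" using m(2) unfolding MOST_nat_le by blast
    have nodeath: "\<not> dead w k i" if "k \<ge> N0" "i \<le> a" for k i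
    proof
      assume "dead w k i"
      then have "2 * i + 1 \<in> emissions ?G (tracker w k)" unfolding dead_def emissions_def by auto
      then have "p k \<le> 2 * i + 1" by (rule p_le)
      then show False using N0[OF that(1)] that(2) a by simp
    qed
    obtain N where N: "N \<ge> N0" "good a N e" using e unfolding INFM_nat_le by blast
    have aN: "a < length (threads w N)"
      using N(2) unfolding good_def merges_def length_tracker length_candidates by auto
    define t where "t = threads w N ! a"
    have stable: "a < length (threads w k) \<and> threads w k ! a = t" if "k \<ge> N" for k
      unfolding t_def using nodeath N(1) aN that by (intro stable_thread) auto
    have "\<exists>\<^sub>\<infinity>k. \<exists>b. merges (tracker w k) b a \<and> snd (tracker w k ! b) ! a = e"
      using e by (rule INFM_mono) (auto simp: good_def)
    then have fac: "factors w (\<phi> (seg w 0 t)) e" using factors_if_stable stable by blast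
    have "candidates w N ! a = t" "a < length (candidates w N)"
      using stable[of N] by (simp_all add: candidates_def nth_append)
    then have "snd (tracker w N ! a) ! 0 = \<phi> (seg w 0 t)"
      using tracker_row[of 0 w N a] candidates_0[of w N] by (simp add: length_candidates)
    then have "(\<phi> (seg w 0 t), e) \<in> ?G" using N(2) unfolding good_def by auto
    then show "w \<in> X" using accepting_iff[OF X fac] by simp
  next
    assume "w \<in> X"
    let ?K = "Suc (card (range \<phi>))"
    have dead_bound: "b < ?K" if "dead w k b" for k b
      using that length_threads[of w k] unfolding dead_def length_candidates by simp
    have "\<exists>\<^sub>\<infinity>k. \<exists>b\<in>{..<?K}. dead w k b"
      using infinitely_many_deaths[of w] by (rule INFM_mono) (use dead_bound in blast)
    from frequently_bex_finite[OF finite_lessThan this] have "\<exists>b. \<exists>\<^sub>\<infinity>k. dead w k b" by blast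
    then obtain b where b: "\<exists>\<^sub>\<infinity>k. dead w k b" "\<And>i. i < b \<Longrightarrow> \<not> (\<exists>\<^sub>\<infinity>k. dead w k i)"
      using exists_least_iff[of "\<lambda>b. \<exists>\<^sub>\<infinity>k. dead w k b"] by blast
    have "\<not> (\<exists>\<^sub>\<infinity>k. \<exists>i\<in>{..<b}. dead w k i)"
      using b(2) frequently_bex_finite[OF finite_lessThan[of b], of "dead w"] by blast
    then obtain N0 where N0: "\<And>k i. k \<ge> N0 \<Longrightarrow> i < b \<Longrightarrow> \<not> dead w k i"
      unfolding INFM_nat_le by auto
    obtain N where N: "N \<ge> N0" "dead w N b" using b(1) unfolding INFM_nat_le by blast
    have bN: "b \<le> length (threads w N)" using N(2) unfolding dead_def length_candidates by simp
    have "\<exists>\<^sub>\<infinity>k. \<exists>(a, e)\<in>{..<b} \<times> range \<phi>. merges (tracker w k) b a \<and> snd (tracker w k ! b) ! a = e"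
      using b(1)
    proof (rule INFM_mono)
      fix k assume "dead w k b"
      then obtain a where a: "merges (tracker w k) b a" using dead_merges by blast
      then have "a < b" "snd (tracker w k ! b) ! a \<in> range \<phi>"
        using tracker_row[of a w k b] unfolding merges_def by auto
      then show "\<exists>(a, e)\<in>{..<b} \<times> range \<phi>. merges (tracker w k) b a \<and> snd (tracker w k ! b) ! a = e"
        using a by auto
    qed
    from frequently_bex_finite[OF finite_cartesian_product[OF finite_lessThan finite_range] this]
    obtain a e where ae: "a < b" "\<exists>\<^sub>\<infinity>k. merges (tracker w k) b a \<and> snd (tracker w k ! b) ! a = e"
      by auto
    define t where "t = threads w N ! a"
    have stable: "a < length (threads w k) \<and> threads w k ! a = t" if "k \<ge> N" for k
      unfolding t_def using N0 N(1) bN ae(1) that by (intro stable_thread) auto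
    have "\<exists>\<^sub>\<infinity>k. \<exists>b. merges (tracker w k) b a \<and> snd (tracker w k ! b) ! a = e"
      using ae(2) by (rule INFM_mono) blast
    then have "factors w (\<phi> (seg w 0 t)) e" using factors_if_stable stable by blast
    \<comment> \<open>The pair is accepting because \<open>w\<close> itself realizes it.\<close>
    then have G: "(\<phi> (seg w 0 t), e) \<in> ?G" using accepting_iff[OF X] \<open>w \<in> X\<close> by blast
    have low: "p k \<le> 2 * a + 2"
      if "k \<ge> N" "merges (tracker w k) b a" "snd (tracker w k ! b) ! a = e" for k
    proof -
      have "candidates w k ! a = t" "a < length (candidates w k)"
        using stable[OF that(1)] by (simp_all add: candidates_def nth_append)
      then have "snd (tracker w k ! a) ! 0 = \<phi> (seg w 0 t)"
        using tracker_row[of 0 w k a] candidates_0[of w k] by (simp add: length_candidates)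
      then have "2 * a + 2 \<in> emissions ?G (tracker w k)"
        unfolding emissions_def using G that by auto
      then show ?thesis by (rule p_le)
    qed
    have "\<forall>\<^sub>\<infinity>k. k \<ge> N \<and> m \<le> p k" using m(2) MOST_ge_nat[of N] by (rule MOST_conjI[rotated])
    then obtain k where "m \<le> p k" "p k \<le> 2 * a + 2"
      using INFM_conjI[OF ae(2)] low INFM_EX by blast
    then have m_le: "m \<le> 2 * a + 2" by simp
    show "even m"
    proof (rule ccontr)
      assume "odd m"
      obtain k where k: "k \<ge> N" "p k = m" using m(1) unfolding INFM_nat_le by blast
      \<comment> \<open>An odd \<open>m\<close> would be the default, which exceeds
        \<open>2a + 2\<close> because \<open>a\<close> is an index of \<open>threads w k\<close>, or
        a death at an index at most \<open>a\<close>, hence below \<open>b\<close>.\<close>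
      have "m = 2 * length (tracker w k) + 1 \<or> (\<exists>i. m = 2 * i + 1 \<and> dead w k i)"
        using p_in[of k] \<open>odd m\<close> unfolding k(2) emissions_def dead_def by auto
      then show False
      proof
        assume "m = 2 * length (tracker w k) + 1"
        then show False using m_le stable[OF k(1)] by (simp add: length_candidates)
      next
        assume "\<exists>i. m = 2 * i + 1 \<and> dead w k i"
        then show False using m_le N0[of k] k(1) N(1) ae(1) by auto
      qed
    qed
  qed
  then show ?thesis
    unfolding parity_wins_def priority_eq p_def[symmetric] using m by blast
qed

end

section \<open>Equilibria for payoffs with parity thresholds\<close>

text \<open>Memory states must be numbers: \<open>e\<close> numbers the set \<open>M\<close> and
  \<open>d\<close> decodes.\<close>

lemma finite_memoryI:
  assumes "finite M" "m0 \<in> M" "\<And>m v. m \<in> M \<Longrightarrow> upd m v \<in> M"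
    and s: "\<And>h. s h = nxt (foldl upd m0 (butlast h)) (last h)"
  shows "finite_memory owner i s"
proof -
  obtain e :: "_ \<Rightarrow> nat" where e: "inj_on e M" using finite_imp_inj_to_nat_seg[OF assms(1)] by blast
  define d where "d = inv_into M e"
  have d: "d (e m) = m" if "m \<in> M" for m unfolding d_def using e that by simp
  have fold: "foldl upd m0 h \<in> M \<and>
      foldl (\<lambda>n v. e (upd (d n) v)) (e m0) h = e (foldl upd m0 h)" for h
    by (induction h rule: rev_induct) (simp_all add: assms(2,3) d)
  show ?thesis
    unfolding finite_memory_def
  proof (intro exI conjI allI impI)
    show "finite (e ` M)" using assms(1) by simp
    show "e m0 \<in> e ` M" using assms(2) by simp
    show "e (upd (d n) v) \<in> e ` M" if "n \<in> e ` M" for n v using that d assms(3) by auto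
    show "s h = (\<lambda>n. nxt (d n)) (foldl (\<lambda>n v. e (upd (d n) v)) (e m0) (butlast h)) (last h)" for h
      unfolding s using fold[of "butlast h"] d by simp
  qed
qed

lemma hist_eq_seg: "hist owner \<sigma> v0 n = seg (outcome owner \<sigma> v0) 0 (Suc n)"
proof (induction n)
  case (Suc n)
  have "hist owner \<sigma> v0 (Suc n) = hist owner \<sigma> v0 n @ [outcome owner \<sigma> v0 (Suc n)]"
    by (simp add: outcome_def)
  also have "\<dots> = seg (outcome owner \<sigma> v0) 0 (Suc (Suc n))"
    by (subst Suc.IH) simp
  finally show ?case .
qed (simp add: outcome_def)

lemma outcome_0 [simp]: "outcome owner \<sigma> v0 0 = v0"
  by (simp add: outcome_def)

lemma outcome_Suc:
  "outcome owner \<sigma> v0 (Suc n) =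
     \<sigma> (owner (outcome owner \<sigma> v0 n)) (seg (outcome owner \<sigma> v0) 0 (Suc n))"
proof -
  have "outcome owner \<sigma> v0 (Suc n) = \<sigma> (owner (last (hist owner \<sigma> v0 n))) (hist owner \<sigma> v0 n)"
    by (simp add: outcome_def)
  then show ?thesis unfolding hist_eq_seg by simp
qed

text \<open>A Mealy machine has read only \<open>butlast h\<close>, so its memory cannot yet know
  whether the last vertex is a deviation. \<open>Expect i x\<close> stores the move \<open>x\<close>
  foreseen for player \<open>i\<close>; \<open>resolve\<close> makes the comparison once the vertex
  is there. \<open>Punish i c\<close> keeps the payoff of \<open>i\<close> below
  \<open>c\<close>.\<close>

datatype ('p, 'v) mode = Conform | Expect 'p 'v | Punish 'p nat

locale parity_payoff_game =
  fixes E :: "('v::finite \<times> 'v) set"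
    and owner :: "'v \<Rightarrow> 'p::finite"
    and Q :: "'q set" and q0 :: 'q and \<delta> :: "'q \<Rightarrow> 'v \<Rightarrow> 'q"
    and pay :: "'p \<Rightarrow> (nat \<Rightarrow> 'v) \<Rightarrow> nat" and N :: nat
    and pr :: "'p \<Rightarrow> nat \<Rightarrow> 'v \<times> 'q \<Rightarrow> nat"
  assumes succ: "\<exists>w. (v, w) \<in> E"
    and finite_Q: "finite Q" and q0: "q0 \<in> Q" and \<delta>: "q \<in> Q \<Longrightarrow> \<delta> q v \<in> Q"
    and pay_le: "pay i w \<le> N"
    and pr: "parity_wins (pr i c) (c \<le> pay i w) (\<lambda>k. (w k, foldl \<delta> q0 (seg w 0 k)))"
begin

section \<open>The product of the arena with the automaton\<close>

definition states :: "('v \<times> 'q) set" where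
  "states = UNIV \<times> Q"

text \<open>The automaton is one vertex behind: in \<open>(v, q)\<close> it has read the vertices
  before \<open>v\<close>, so \<open>pr\<close> sees a letter together with the state that reads
  it.\<close>

definition moves :: "(('v \<times> 'q) \<times> ('v \<times> 'q)) set" where
  "moves = {((v, q), (v', \<delta> q v)) | v q v'. (v, v') \<in> E}"

lemma move_iff: "(s, s') \<in> moves \<longleftrightarrow> snd s' = \<delta> (snd s) (fst s) \<and> (fst s, fst s') \<in> E"
  unfolding moves_def by (cases s; cases s') auto

definition state :: "(nat \<Rightarrow> 'v) \<Rightarrow> nat \<Rightarrow> 'v \<times> 'q" where
  "state w k = (w k, foldl \<delta> q0 (seg w 0 k))"

lemma fst_state [simp]: "fst (state w k) = w k"
  by (simp add: state_def)

lemma state_in: "state w k \<in> states"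
proof -
  have "foldl \<delta> q0 h \<in> Q" for h by (induction h rule: rev_induct) (simp_all add: q0 \<delta>)
  then show ?thesis by (simp add: state_def states_def)
qed

lemma state_move: "(state w k, state w (Suc k)) \<in> moves \<longleftrightarrow> (w k, w (Suc k)) \<in> E"
  unfolding state_def move_iff by simp

lemma state_eqI: "snd s = \<delta> (snd (state w k)) (w k) \<Longrightarrow> fst s = w (Suc k) \<Longrightarrow> state w (Suc k) = s"
  unfolding state_def by (cases s) simp

lemma pay_parity: "parity_wins (pr i c) a (state w) \<Longrightarrow> a \<longleftrightarrow> c \<le> pay i w"
  using parity_wins_unique[OF _ pr[of i c w]] unfolding state_def by blast

abbreviation "owned i \<equiv> (\<lambda>s. owner (fst s) = i)"

text \<open>Player \<open>i\<close> takes the role \<open>True\<close>, the coalition of all others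
  the role \<open>False\<close>.\<close>

lemma ex_regions:
  "\<exists>W f g. region moves (owned i) (pr i c) states True W f \<and>
           region moves (owned i) (pr i c) states False (states - W) g"
proof -
  have "finite states" unfolding states_def using finite_Q by simp
  moreover have "\<exists>s'\<in>states. (s, s') \<in> moves" if "s \<in> states" for s
  proof -
    obtain v q where s: "s = (v, q)" by (cases s)
    obtain v' where "(v, v') \<in> E" using succ by blast
    then show ?thesis
      using that \<delta> by (intro bexI[of _ "(v', \<delta> q v)"]) (auto simp: s move_iff states_def)
  qed
  ultimately show ?thesis
    using parity_determinacy[of states moves "owned i" "pr i c" True] by simp
qed

section \<open>Values and the strategies that enforce them\<close>

definition win :: "'p \<Rightarrow> nat \<Rightarrow> ('v \<times> 'q) set" where
  "win i c = (SOME W. \<exists>f g. region moves (owned i) (pr i c) states True W f \<and>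
           region moves (owned i) (pr i c) states False (states - W) g)"

definition attack :: "'p \<Rightarrow> nat \<Rightarrow> 'v \<times> 'q \<Rightarrow> 'v \<times> 'q" where
  "attack i c = (SOME f. region moves (owned i) (pr i c) states True (win i c) f)"

definition defend :: "'p \<Rightarrow> nat \<Rightarrow> 'v \<times> 'q \<Rightarrow> 'v \<times> 'q" where
  "defend i c = (SOME g. region moves (owned i) (pr i c) states False (states - win i c) g)"

lemma regions:
  "region moves (owned i) (pr i c) states True (win i c) (attack i c)"
  "region moves (owned i) (pr i c) states False (states - win i c) (defend i c)"
proof -
  have *: "\<exists>f g. region moves (owned i) (pr i c) states True (win i c) f \<and>
           region moves (owned i) (pr i c) states False (states - win i c) g"
    unfolding win_def by (rule someI_ex[OF ex_regions])
  then have "\<exists>f. region moves (owned i) (pr i c) states True (win i c) f" by blast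
  then show "region moves (owned i) (pr i c) states True (win i c) (attack i c)"
    unfolding attack_def by (rule someI_ex)
  from * have "\<exists>g. region moves (owned i) (pr i c) states False (states - win i c) g" by blast
  then show "region moves (owned i) (pr i c) states False (states - win i c) (defend i c)"
    unfolding defend_def by (rule someI_ex)
qed

text \<open>States that are not reachable from the initial memory may lie outside \<open>win i 0\<close>; the
  disjunct \<open>c = 0\<close> keeps the set nonempty for them.\<close>

definition val :: "'p \<Rightarrow> 'v \<times> 'q \<Rightarrow> nat" where
  "val i s = Max {c. c \<le> N \<and> (c = 0 \<or> s \<in> win i c)}"

lemma val: "val i s \<le> N" "val i s = 0 \<or> s \<in> win i (val i s)"
proof -
  have "val i s \<in> {c. c \<le> N \<and> (c = 0 \<or> s \<in> win i c)}"
    unfolding val_def by (rule Max_in) auto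
  then show "val i s \<le> N" "val i s = 0 \<or> s \<in> win i (val i s)" by auto
qed

lemma val_ge: "c \<le> N \<Longrightarrow> s \<in> win i c \<Longrightarrow> c \<le> val i s"
  unfolding val_def by (rule Max_ge) auto

text \<open>Outside the region where a positional strategy is meaningful, its move may not be an
  edge; it is then replaced by an arbitrary legal one.\<close>

definition legal :: "'v \<Rightarrow> 'v \<Rightarrow> 'v" where
  "legal v x = (if (v, x) \<in> E then x else SOME x. (v, x) \<in> E)"

lemma legal: "(v, legal v x) \<in> E"
  unfolding legal_def using someI_ex[OF succ] by simp

text \<open>One function serves all players, because the owner of the current vertex is the one
  whose value is pursued.\<close>

definition main :: "'v \<times> 'q \<Rightarrow> 'v" where
  "main s = legal (fst s) (fst (attack (owner (fst s)) (val (owner (fst s)) s) s))"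

definition punish :: "'p \<Rightarrow> nat \<Rightarrow> 'v \<times> 'q \<Rightarrow> 'v" where
  "punish i c s = legal (fst s) (fst (defend i c s))"

lemma attack_eq:
  assumes "state w k \<in> win i c" "owner (w k) = i" "c = val i (state w k)" "w (Suc k) = main (state w k)"
  shows "state w (Suc k) = attack i c (state w k)"
proof -
  let ?s = "state w k"
  have fst_s: "fst ?s = w k" by (simp add: state_def)
  have "(?s, attack i c ?s) \<in> moves" using regionD(3)[OF regions(1) assms(1)] assms(2) fst_s by simp
  then have m: "snd (attack i c ?s) = \<delta> (snd ?s) (w k)" "(w k, fst (attack i c ?s)) \<in> E"
    unfolding move_iff fst_s by simp_all
  then have "fst (attack i c ?s) = w (Suc k)"
    using assms(2-4) fst_s by (simp add: main_def legal_def)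
  then show ?thesis using m(1) by (intro state_eqI)
qed

lemma defend_eq:
  assumes "state w k \<in> states - win i c" "owner (w k) \<noteq> i" "w (Suc k) = punish i c (state w k)"
  shows "state w (Suc k) = defend i c (state w k)"
proof -
  let ?s = "state w k"
  have fst_s: "fst ?s = w k" by (simp add: state_def)
  have "(?s, defend i c ?s) \<in> moves" using regionD(3)[OF regions(2) assms(1)] assms(2) fst_s by simp
  then have m: "snd (defend i c ?s) = \<delta> (snd ?s) (w k)" "(w k, fst (defend i c ?s)) \<in> E"
    unfolding move_iff fst_s by simp_all
  then have "fst (defend i c ?s) = w (Suc k)"
    using assms(3) fst_s by (simp add: punish_def legal_def)
  then show ?thesis using m(1) by (intro state_eqI)
qed

text \<open>Along a play where player i always plays for the current value, this value never
  decreases, so that the strategy of the player is eventually a fixed winning one.\<close>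

lemma main_guarantees_val:
  assumes edge: "\<And>l. (w l, w (Suc l)) \<in> E"
    and main: "\<And>l. owner (w l) = i \<Longrightarrow> w (Suc l) = main (state w l)"
  shows "val i (state w k) \<le> pay i w"
proof -
  let ?v = "\<lambda>l. val i (state w l)"
  have mono: "?v l \<le> ?v (Suc l)" for l
  proof (cases "?v l = 0")
    case False
    then have W: "state w l \<in> win i (?v l)" using val(2)[of i "state w l"] by simp
    have "state w (Suc l) \<in> win i (?v l)"
    proof (cases "owner (w l) = i")
      case True
      then have "state w (Suc l) = attack i (?v l) (state w l)" using attack_eq[OF W] main by blast
      then show ?thesis using regionD(2)[OF regions(1) W] True by simp
    next
      case False
      then show ?thesis
        using regionD(4)[OF regions(1) W _ state_in[of w "Suc l"]] state_move edge by simp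
    qed
    then show ?thesis using val_ge val(1) by blast
  qed simp
  \<comment> \<open>From \<open>k\<close> on, the bounded value is largest at some time
    \<open>L\<close>; by monotonicity it is constant afterwards.\<close>
  have "\<exists>L. k \<le> L \<and> (\<forall>l. k \<le> l \<longrightarrow> ?v l \<le> ?v L)"
    by (rule ex_has_greatest_nat[of _ k _ "Suc N"]) (use val(1)[of i] in \<open>auto simp: less_Suc_eq_le\<close>)
  then obtain L where L: "k \<le> L" "\<And>l. k \<le> l \<Longrightarrow> ?v l \<le> ?v L" by blast
  have const: "?v l = ?v L" if "l \<ge> L" for l
    using L lift_Suc_mono_le[of ?v, OF mono that] that by (simp add: order_antisym)
  show ?thesis
  proof (cases "?v L = 0")
    case True
    then show ?thesis using L(2)[of k] by simp
  next
    case False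
    have W: "state w l \<in> win i (?v L)" if "l \<ge> L" for l
      using const[OF that] val(2)[of i "state w l"] False by simp
    have "parity_wins (pr i (?v L)) True (state w)"
    proof (rule region_eventually_wins[OF regions(1), of L])
      fix l assume l: "l \<ge> L"
      show "state w l \<in> win i (?v L)" using W[OF l] .
      show "(state w l, state w (Suc l)) \<in> moves" using state_move edge by blast
      show "state w (Suc l) = attack i (?v L) (state w l)" if "(owner (fst (state w l)) = i) = True"
        using that main[of l] attack_eq[OF W[OF l]] const[OF l] by simp
    qed
    then have "?v L \<le> pay i w" using pay_parity by blast
    then show ?thesis using L(2)[of k] by simp
  qed
qed

section \<open>The Mealy machine of the equilibrium\<close>

fun resolve :: "('p, 'v) mode \<Rightarrow> 'v \<times> 'q \<Rightarrow> ('p, 'v) mode" where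
  "resolve (Expect i x) s = (if fst s = x then Conform else Punish i (Suc (val i s)))"
| "resolve m s = m"

fun action :: "('p, 'v) mode \<Rightarrow> 'v \<times> 'q \<Rightarrow> 'v" where
  "action (Punish i c) s = punish i c s"
| "action m s = main s"

fun next_mode :: "('p, 'v) mode \<Rightarrow> 'v \<times> 'q \<Rightarrow> ('p, 'v) mode" where
  "next_mode (Punish i c) s = Punish i c"
| "next_mode m s = Expect (owner (fst s)) (main s)"

definition update :: "'q \<times> ('p, 'v) mode \<Rightarrow> 'v \<Rightarrow> 'q \<times> ('p, 'v) mode" where
  "update = (\<lambda>(q, m) v. (\<delta> q v, next_mode (resolve m (v, q)) (v, q)))"

lemma update_eq:
  "update m v = (\<delta> (fst m) v, next_mode (resolve (snd m) (v, fst m)) (v, fst m))"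
  by (simp add: update_def case_prod_beta)

definition decide :: "'q \<times> ('p, 'v) mode \<Rightarrow> 'v \<Rightarrow> 'v" where
  "decide = (\<lambda>(q, m) v. action (resolve m (v, q)) (v, q))"

definition strategy :: "'v list \<Rightarrow> 'v" where
  "strategy h = decide (foldl update (q0, Conform) (butlast h)) (last h)"

lemma strategy_finite_memory: "finite_memory owner i strategy"
proof -
  let ?M = "Q \<times> (insert Conform (case_prod Expect ` (UNIV :: ('p \<times> 'v) set) \<union>
    case_prod Punish ` (UNIV \<times> {..Suc N})))"
  show ?thesis
  proof (rule finite_memoryI[where M = ?M and upd = update and nxt = decide])
    show "finite ?M" 
      by (intro finite_cartesian_product finite_Q finite.insertI finite_UnI finite_imageI finite_atMost) simp_all
    show "(q0, Conform) \<in> ?M" using q0 by simp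
    show "update m v \<in> ?M" if "m \<in> ?M" for m v
    proof -
      obtain q x where m: "m = (q, x)" by (cases m)
      have Suc_val: "Suc (val i s) \<le> Suc N" for i s using val(1)[of i s] by simp
      show ?thesis
        using that \<delta>[of q v] Suc_val
        by (cases x) (auto simp: m update_def image_iff)
    qed
  qed (rule strategy_def)
qed

lemma strategy_legal: "is_strategy E owner i strategy"
  unfolding is_strategy_def
proof (intro allI impI)
  fix h :: "'v list"
  obtain q m where "foldl update (q0, Conform) (butlast h) = (q, m)" by fastforce
  moreover have "(v, action m' (v, q)) \<in> E" for m' v q
    by (cases m') (simp_all add: main_def punish_def legal)
  ultimately show "(last h, strategy h) \<in> E" by (simp add: strategy_def decide_def)
qed

definition mode :: "(nat \<Rightarrow> 'v) \<Rightarrow> nat \<Rightarrow> ('p, 'v) mode" where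
  "mode w k = resolve (snd (foldl update (q0, Conform) (seg w 0 k))) (state w k)"

lemma memory_state: "fst (foldl update (q0, Conform) h) = foldl \<delta> q0 h"
  by (induction h rule: rev_induct) (simp_all add: update_def case_prod_beta)

lemma strategy_seg: "strategy (seg w 0 (Suc k)) = action (mode w k) (state w k)"
  unfolding strategy_def decide_def mode_def state_def case_prod_beta memory_state by simp

lemma mode_0: "mode w 0 = Conform"
  by (simp add: mode_def)

lemma mode_Suc: "mode w (Suc k) = resolve (next_mode (mode w k) (state w k)) (state w (Suc k))"
  unfolding mode_def by (simp add: update_eq memory_state state_def)

lemma mode_Conform:
  "(\<And>l. l < k \<Longrightarrow> w (Suc l) = main (state w l)) \<Longrightarrow> mode w k = Conform"
proof (induction k)
  case (Suc k)
  then have "mode w k = Conform" "w (Suc k) = main (state w k)" by simp_all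
  then show ?case by (simp add: mode_Suc)
qed (rule mode_0)

lemma state_cong: "(\<And>l. l \<le> k \<Longrightarrow> w l = w' l) \<Longrightarrow> state w k = state w' k"
  unfolding state_def by (auto intro!: arg_cong[of _ _ "foldl \<delta> q0"])

section \<open>Deviations and their punishment\<close>

lemma main_plays_agree:
  assumes "w 0 = w' 0" "\<And>l. l < k \<Longrightarrow> w (Suc l) = main (state w l)"
    "\<And>l. l < k \<Longrightarrow> w' (Suc l) = main (state w' l)" "l \<le> k"
  shows "w l = w' l"
  using \<open>l \<le> k\<close>
proof (induction l rule: less_induct)
  case (less l)
  show ?case
  proof (cases l)
    case (Suc m)
    then have "state w m = state w' m" using less by (intro state_cong) auto
    then show ?thesis using assms(2,3)[of m] less.prems Suc by simp
  qed (use assms(1) in simp)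
qed

text \<open>A threshold above \<open>N\<close> is missed by every play; otherwise the coalition
  keeps the play outside \<open>win i c\<close> and wins there.\<close>

lemma punishment:
  assumes edge: "\<And>l. (w l, w (Suc l)) \<in> E"
    and start: "c \<le> N \<Longrightarrow> state w k \<notin> win i c"
    and punish: "\<And>l. l \<ge> k \<Longrightarrow> owner (w l) \<noteq> i \<Longrightarrow> w (Suc l) = punish i c (state w l)"
  shows "pay i w < c"
proof (cases "c \<le> N")
  case True
  have edge': "(state w l, state w (Suc l)) \<in> moves" for l using state_move edge by blast
  have D: "state w l \<in> states - win i c" if "l \<ge> k" for l
    using that
  proof (induction l rule: dec_induct)
    case base
    show ?case using start[OF True] state_in by blast
  next
    case (step l)
    show ?case
    proof (cases "owner (w l) = i")
      case True
      then show ?thesis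
        using regionD(4)[OF regions(2) step(3) _ state_in[of w "Suc l"]] edge' by simp
    next
      case False
      then have "state w (Suc l) = defend i c (state w l)" using defend_eq[OF step(3)] punish step(1) by blast
      then show ?thesis using regionD(2)[OF regions(2) step(3)] False by simp
    qed
  qed
  have "parity_wins (pr i c) False (state w)"
  proof (rule region_eventually_wins[OF regions(2), of k])
    fix l assume l: "l \<ge> k"
    show "state w l \<in> states - win i c" using D[OF l] .
    show "(state w l, state w (Suc l)) \<in> moves" by (rule edge')
    show "state w (Suc l) = defend i c (state w l)" if "(owner (fst (state w l)) = i) = False"
      using that punish[OF l] defend_eq[OF D[OF l]] by simp
  qed
  then have "\<not> c \<le> pay i w" using pay_parity by blast
  then show ?thesis by simp
next
  case False
  then show ?thesis using pay_le[of i w] by simp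
qed

text \<open>At the first departure from \<open>main\<close> the mode is still
  \<open>Conform\<close>, so the departing player is \<open>i\<close>. Player \<open>i\<close>
  cannot raise the own value by a move of \<open>i\<close>, hence the punished payoff is at most the
  value before the departure, and the equilibrium play pays at least that much.\<close>

lemma no_profitable_deviation:
  assumes \<tau>: "is_strategy E owner i \<tau>"
  shows "pay i (outcome owner ((\<lambda>_. strategy)(i := \<tau>)) v0) \<le> pay i (outcome owner (\<lambda>_. strategy) v0)"
proof -
  define w where "w = outcome owner ((\<lambda>_. strategy)(i := \<tau>)) v0"
  define \<rho> where "\<rho> = outcome owner (\<lambda>_. strategy) v0"
  have start: "w 0 = \<rho> 0" by (simp add: w_def \<rho>_def)
  have \<rho>_action: "\<rho> (Suc k) = action (mode \<rho> k) (state \<rho> k)" for k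
    unfolding strategy_seg[symmetric] \<rho>_def by (rule outcome_Suc)
  have "mode \<rho> k = Conform \<and> \<rho> (Suc k) = main (state \<rho> k)" for k
  proof (induction k rule: less_induct)
    case (less k)
    then have "mode \<rho> k = Conform" by (intro mode_Conform) blast
    then show ?case using \<rho>_action[of k] by simp
  qed
  then have \<rho>_main: "\<rho> (Suc k) = main (state \<rho> k)" for k by blast
  have \<rho>_edge: "(\<rho> k, \<rho> (Suc k)) \<in> E" for k
    unfolding \<rho>_main main_def using legal[of "\<rho> k"] by simp
  have w_Suc: "w (Suc k) = (if owner (w k) = i then \<tau> else strategy) (seg w 0 (Suc k))" for k
    using outcome_Suc[of owner "(\<lambda>_. strategy)(i := \<tau>)" v0 k] unfolding w_def[symmetric]
    by (simp only: fun_upd_def)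
  have w_action: "w (Suc k) = action (mode w k) (state w k)" if "owner (w k) \<noteq> i" for k
    using w_Suc[of k] that unfolding strategy_seg[symmetric] by (simp only: if_False)
  have w_edge: "(w k, w (Suc k)) \<in> E" for k
  proof -
    have h: "seg w 0 (Suc k) \<noteq> []" "last (seg w 0 (Suc k)) = w k" by simp_all
    show ?thesis
      using \<tau> strategy_legal[of "owner (w k)"] h w_Suc[of k]
      unfolding is_strategy_def by (metis (full_types))
  qed
  have "pay i w \<le> pay i \<rho>"
  proof (cases "\<forall>k. w (Suc k) = main (state w k)")
    case True
    then have "w l = \<rho> l" for l
      using \<rho>_main by (intro main_plays_agree[of w \<rho>, where k = l, OF start]) simp_all
    then have "w = \<rho>" by blast
    then show ?thesis by simp
  next
    case False
    then obtain k where k: "w (Suc k) \<noteq> main (state w k)"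
      "\<And>l. l < k \<Longrightarrow> w (Suc l) = main (state w l)"
      using exists_least_iff[of "\<lambda>k. w (Suc k) \<noteq> main (state w k)"] by blast
    have conform: "mode w k = Conform" using k(2) by (rule mode_Conform)
    then have i: "owner (w k) = i" using w_action[of k] k(1) by auto
    have same: "state w k = state \<rho> k"
      using k(2) \<rho>_main by (intro state_cong main_plays_agree[of w \<rho>, where k = k, OF start]) simp_all
    \<comment> \<open>By maximality of the value, \<open>c\<close> is a threshold that
      \<open>i\<close> cannot enforce from the state reached, or it exceeds the bound on
      payoffs.\<close>
    define c where "c = Suc (val i (state w (Suc k)))"
    have mode: "mode w l = Punish i c" if "l \<ge> Suc k" for l
      using that
    proof (induction l rule: dec_induct)
      case base
      show ?case
        unfolding mode_Suc conform using k(1) i by (simp add: c_def)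
    qed (simp add: mode_Suc)
    have "pay i w < c"
    proof (rule punishment[where k = "Suc k"])
      show "(w l, w (Suc l)) \<in> E" for l by (rule w_edge)
      show "state w (Suc k) \<notin> win i c" if "c \<le> N"
        using val_ge[OF that] unfolding c_def by fastforce
      show "w (Suc l) = punish i c (state w l)" if "l \<ge> Suc k" "owner (w l) \<noteq> i" for l
        using w_action[OF that(2)] mode[OF that(1)] by simp
    qed
    moreover have "val i (state w (Suc k)) \<le> val i (state w k)"
    proof (cases "val i (state w (Suc k)) = 0")
      case False
      let ?c = "val i (state w (Suc k))"
      have W: "state w (Suc k) \<in> win i ?c"
        using val(2)[of i "state w (Suc k)"] False by simp
      \<comment> \<open>The complement of \<open>win i ?c\<close> is a region of the coalition and
        hence closed under the moves of \<open>i\<close>.\<close>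
      have "state w k \<in> win i ?c"
      proof (rule ccontr)
        assume "\<not> ?thesis"
        then have "state w k \<in> states - win i ?c" using state_in by blast
        from regionD(4)[OF regions(2) this _ state_in] W show False
          using i state_move w_edge by auto
      qed
      then show ?thesis using val_ge val(1) by blast
    qed simp
    moreover have "val i (state \<rho> k) \<le> pay i \<rho>"
      using \<rho>_edge \<rho>_main by (intro main_guarantees_val) blast+
    ultimately show ?thesis using same by (simp add: c_def)
  qed
  then show ?thesis unfolding w_def \<rho>_def .
qed

end

section \<open>Recognizable preorders\<close>

lemma same_factors_sym: "same_factors \<phi> w w' \<Longrightarrow> same_factors \<phi> w' w"
  unfolding same_factors_def by metis

lemma recognizes_iff: "recognizes \<phi> X \<Longrightarrow> same_factors \<phi> w w' \<Longrightarrow> w \<in> X \<longleftrightarrow> w' \<in> X"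
  unfolding recognizes_def using same_factors_sym by blast

text \<open>Replaces a possibly non-total preference by a payoff function with finitely many values.\<close>

lemma strict_pref_rank:
  assumes R: "trans R"
    and type: "\<And>x x' y y'. t x = t x' \<Longrightarrow> t y = t y' \<Longrightarrow> (x, y) \<in> R \<longleftrightarrow> (x', y') \<in> R"
    and fin: "finite (range t)"
    and xy: "strict_pref R x y"
  shows "card (t ` {z. strict_pref R z x}) < card (t ` {z. strict_pref R z y})"
proof (rule psubset_card_mono)
  show "finite (t ` {z. strict_pref R z y})" using fin by (rule finite_subset[rotated]) blast
  have "{z. strict_pref R z x} \<subseteq> {z. strict_pref R z y}"
    using xy R unfolding strict_pref_def by (blast dest: transD)
  \<comment> \<open>The type of \<open>x\<close> is counted for \<open>y\<close> but not for
    \<open>x\<close>, which makes the inclusion strict.\<close>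
  moreover have "t x \<in> t ` {z. strict_pref R z y}" using xy by blast
  moreover have "t x \<notin> t ` {z. strict_pref R z x}"
  proof
    assume "t x \<in> t ` {z. strict_pref R z x}"
    then obtain z where z: "t z = t x" "strict_pref R z x" by auto
    then show False using type[OF z(1) refl, of x] type[OF refl z(1), of x] unfolding strict_pref_def by simp
  qed
  ultimately show "t ` {z. strict_pref R z x} \<subset> t ` {z. strict_pref R z y}" by blast
qed

theorem theorem11:
  fixes E :: "('v::finite \<times> 'v) set"
    and owner :: "'v \<Rightarrow> 'p::finite"
    and pref :: "'p \<Rightarrow> ((nat \<Rightarrow> 'v) \<times> (nat \<Rightarrow> 'v)) set"
  assumes succ: "\<forall>v. \<exists>w. (v, w) \<in> E"
    and preorder: "\<forall>i. refl (pref i) \<and> trans (pref i)"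
    and recog: "\<forall>i. omega_recognizable (pref i)"
  shows "\<forall>v0. \<exists>\<sigma>. nash_equilibrium E owner pref \<sigma> v0 \<and>
                   (\<forall>i. finite_memory owner i (\<sigma> i))"
proof -
  from recog[unfolded omega_recognizable_def, THEN choice] obtain XY where
    XY: "\<forall>i. (\<forall>(X, Y) \<in> set (XY i). omega_regular X \<and> omega_regular Y) \<and>
         pref i = (\<Union>(X, Y) \<in> set (XY i). X \<times> Y)" ..
  have regular: "omega_regular X \<and> omega_regular Y" if "(X, Y) \<in> set (XY i)" for i X Y
    using conjunct1[OF XY[rule_format, of i]] that by fast
  have pref_eq: "pref i = (\<Union>(X, Y) \<in> set (XY i). X \<times> Y)" for i
    using conjunct2[OF XY[rule_format, of i]] .
  \<comment> \<open>The languages of all players are collected, so that one automaton can serve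
    every player.\<close>
  define \<X> where "\<X> = (\<Union>i. fst ` set (XY i) \<union> snd ` set (XY i))"
  have \<X>: "finite \<X>" "\<And>X. X \<in> \<X> \<Longrightarrow> omega_regular X"
    unfolding \<X>_def using regular by auto
  obtain \<phi> :: "'v list \<Rightarrow> (nat \<times> nat \<times> bool) set list"
    where \<phi>: "finite_congruence \<phi>" "\<And>X. X \<in> \<X> \<Longrightarrow> recognizes \<phi> X"
    using finite_omega_regular_recognized[OF \<X>] by blast
  define t where "t w = {X \<in> \<X>. w \<in> X}" for w
  have t_fin: "finite (range t)"
    by (rule finite_subset[of _ "Pow \<X>"]) (auto simp: t_def \<X>(1))
  have t_pref: "(x, y) \<in> pref i \<longleftrightarrow> (x', y') \<in> pref i" if "t x = t x'" "t y = t y'" for x x' y y' i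
  proof -
    have "x \<in> X \<longleftrightarrow> x' \<in> X" "y \<in> Y \<longleftrightarrow> y' \<in> Y" if "(X, Y) \<in> set (XY i)" for X Y
    proof -
      have "X \<in> \<X>" "Y \<in> \<X>" unfolding \<X>_def using that by force+
      then show "x \<in> X \<longleftrightarrow> x' \<in> X" "y \<in> Y \<longleftrightarrow> y' \<in> Y"
        using \<open>t x = t x'\<close> \<open>t y = t y'\<close> unfolding t_def by blast+
    qed
    then show ?thesis unfolding pref_eq by blast
  qed
  define pay where "pay i w = card (t ` {z. strict_pref (pref i) z w})" for i w
  have pay_less: "pay i x < pay i y" if "strict_pref (pref i) x y" for i x y
    unfolding pay_def
  proof (rule strict_pref_rank)
    show "trans (pref i)" using preorder by blast
    show "(x, y) \<in> pref i \<longleftrightarrow> (x', y') \<in> pref i" if "t x = t x'" "t y = t y'" for x x' y y'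
      using that by (rule t_pref)
  qed (rule t_fin, rule that)
  have pay_le: "pay i w \<le> card (range t)" for i w
    unfolding pay_def using t_fin by (intro card_mono) auto
  have pay_recognized: "recognizes \<phi> {w. c \<le> pay i w}" for i c
    unfolding recognizes_def
  proof (intro allI impI)
    fix w w' assume "same_factors \<phi> w w'" and w: "w \<in> {w. c \<le> pay i w}"
    \<comment> \<open>Words with equal factor values lie in the same languages of
      \<open>\<X>\<close>, so they have the same type and the same payoff.\<close>
    then have "t w = t w'" unfolding t_def using \<phi>(2) recognizes_iff by blast
    then have "strict_pref (pref i) z w \<longleftrightarrow> strict_pref (pref i) z w'" for z
      unfolding strict_pref_def using t_pref by blast
    then show "w' \<in> {w. c \<le> pay i w}" using w unfolding pay_def by simp
  qed
  interpret word_congruence \<phi>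
    using \<phi>(1) unfolding finite_congruence_def by unfold_locales blast+
  interpret parity_payoff_game E owner "range (foldl step init)" init step pay "card (range t)"
    "\<lambda>i c. priority (accepting {w. c \<le> pay i w})"
  proof
    show "\<exists>w. (v, w) \<in> E" for v using succ by blast
    show "finite (range (foldl step init))" by (rule finite_states)
    show "init \<in> range (foldl step init)" by (rule range_eqI[of _ _ "[]"]) simp
    show "step q v \<in> range (foldl step init)" if q: "q \<in> range (foldl step init)" for q v
    proof -
      obtain u where "q = foldl step init u" using q by blast
      then show ?thesis by (intro range_eqI[of _ _ "u @ [v]"]) simp
    qed
    show "pay i w \<le> card (range t)" for i w by (rule pay_le)
    show "parity_wins (priority (accepting {w. c \<le> pay i w})) (c \<le> pay i w)
        (\<lambda>k. (w k, foldl step init (seg w 0 k)))" for i c w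
      using parity_automaton[OF pay_recognized, of c i w] by simp
  qed
  show ?thesis
  proof
    fix v0
    \<comment> \<open>A strictly preferred outcome would have a larger payoff by
      \<open>pay_less\<close>, which no deviation attains.\<close>
    have "nash_equilibrium E owner pref (\<lambda>_. strategy) v0"
      unfolding nash_equilibrium_def
      using strategy_legal no_profitable_deviation pay_less by (meson not_less)
    then show "\<exists>\<sigma>. nash_equilibrium E owner pref \<sigma> v0 \<and> (\<forall>i. finite_memory owner i (\<sigma> i))"
      using strategy_finite_memory by blast
  qed
qed

end
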